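(* Assume that $\mathrm{zer}(G)\neq\emptyset$ and that $G=\frac1n\sum_{i=1}^nG_i$ satisfies, for some $L\in(0,+\infty)$ and all $x,y\in\mathbb{R}^p$, $$\frac1n\sum_{i=1}^n\langle G_ix-G_iy,x-y\rangle\ \ge\ \frac1L\Big[\frac1n\sum_{i=1}^n\|G_ix-G_iy\|^2\Big].$$ Let $\{x^k\}$ be generated by (VFKM) with the SAGA estimator with mini-batch size $b$ such that $1\le b\le\min\{n,4n^{2/3}\}$, and with $$\theta_k:=\frac{k}{k+5},\quad\gamma_k:=\frac{k}{k+3},\quad\eta_k:=\frac{2\beta(k+3)}{k+5},\quad\beta:=\frac{b^3}{2L(b^3+64n^2)}.$$ Then $\beta\in\big[\frac1{2L(1+64n^2)},\frac1{4L}\big]$. Moreover, for any $x^\star\in\mathrm{zer}(G)$ and all $k\ge0$, $$\mathbb{E}[\|x^{k+1}-x^k\|^2]\le\frac{C_2\|x^0-x^\star\|^2}{(k+5)^2},\qquad\lim_{k\to\infty}k^2\,\mathbb{E}[\|x^{k+1}-x^k\|^2]=0,$$ $$\mathbb{E}[\|Gx^k\|^2]\le\frac{C_3\|x^0-x^\star\|^2}{\beta^2(k+2)(k+5)},\qquad\lim_{k\to\infty}k^2\,\mathbb{E}[\|Gx^k\|^2]=0,$$ where $C_2\le2559$ and $C_3\le3636$ are the explicit constants given in the context. For a given $\epsilon>0$, if $b$ is chosen of exact order $n^{2/3}$, then (VFKM) requires, in expectation, $\mathcal{O}\big(n+\frac{n^{2/3}L\mathcal{R}_0}{\epsilon}\big)$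 evaluations of $G_i$ to achieve $\mathbb{E}[\|Gx^k\|^2]\le\epsilon^2$, where $\mathcal{R}_0:=\|x^0-x^\star\|$.
   Context: Setting. $n,p\ge1$ are integers, $[n]=\{1,\dots,n\}$, $G_i:\mathbb{R}^p\to\mathbb{R}^p$ are single-valued mappings, $Gx:=\frac1n\sum_{i=1}^nG_ix$, $\mathrm{zer}(G):=\{x: Gx=0\}$. Method (VFKM). Given (deterministic) $x^0\in\mathbb{R}^p$, set $x^{-1}:=x^0$. At each $k\ge0$ construct an estimator $\widetilde S^k$ of $S^k:=Gx^k-\gamma_kGx^{k-1}$ (with $\widetilde S^0:=S^0$), and update $x^{k+1}:=x^k+\theta_k(x^k-x^{k-1})-\eta_k\widetilde S^k$. SAGA estimator. Set $\widehat G_i^0:=G_ix^0$ for $i\in[n]$. For $k\ge1$, with fresh randomness, draw an i.i.d. (uniform, with replacement) mini-batch $\mathcal{B}_k\subseteq[n]$ of size $b$ and, independently of $\mathcal{B}_k$, a uniformly random $\hat{\mathcal{B}}_k\subseteq[n]$ of size $b$ without replacement. Set $\widehat G_i^k:=G_ix^{k-1}$ if $i\in\hat{\mathcal{B}}_k$ and $\widehat G_i^k:=\widehat G_i^{k-1}$ otherwise. With $G_{\mathcal{B}_k}x:=\frac1b\sum_{i\in\mathcal{B}_k}G_ix$ and $\widehat G_{\mathcal{B}_k}^k:=\frac1b\sum_{i\in\mathcal{B}_k}\widehat G_i^k$, $$\widetilde S^k:=\frac{1-\gamma_k}{n}\sum_{i=1}^n\widehat G_i^k+\big[G_{\mathcal{B}_k}x^k-\gamma_kG_{\mathcal{B}_k}x^{k-1}-(1-\gamma_k)\widehat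 G_{\mathcal{B}_k}^k\big].$$ Constants: $\psi:=\frac{64n^2}{64n^2+b^3}$, $C_0:=3(10+24L^2\beta^2)$, $C_1:=\frac{72L^2\beta^2}{5}+(\frac23+\psi)C_0$, $C_2:=36L^2\beta^2+(\frac{50}{3}+\psi)C_0+\frac{100C_1}{3}$, $C_3:=\frac{25(C_1+C_2)}{18}$. Oracle complexity counts evaluations of the individual mappings $G_i$ at a point (the initial table costs $n$, a mini-batch evaluation costs $b$). Constants hidden in $\mathcal{O}$ do not depend on $n,L,\mathcal{R}_0,\epsilon$. *)

theory Defs
  imports "HOL-Probability.Probability"
begin

definition avg_map :: "nat \<Rightarrow> (nat \<Rightarrow> real^'p \<Rightarrow> real^'p) \<Rightarrow> real^'p \<Rightarrow> real^'p" where
  "avg_map n G x = (1 / real n) *\<^sub>R (\<Sum>i\<in>{1..n}. G i x)"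

definition zer :: "(real^'p \<Rightarrow> real^'p) \<Rightarrow> (real^'p) set" where
  "zer F = {x. F x = 0}"

definition average_cocoercive :: "nat \<Rightarrow> real \<Rightarrow> (nat \<Rightarrow> real^'p \<Rightarrow> real^'p) \<Rightarrow> bool" where
  "average_cocoercive n L G \<longleftrightarrow>
     (\<forall>x y. (1 / real n) * (\<Sum>i\<in>{1..n}. (G i x - G i y) \<bullet> (x - y))
            \<ge> (1 / L) * ((1 / real n) * (\<Sum>i\<in>{1..n}. (norm (G i x - G i y))\<^sup>2)))"


definition beta :: "nat \<Rightarrow> nat \<Rightarrow> real \<Rightarrow> real" where
  "beta n b L = real b ^ 3 / (2 * L * (real b ^ 3 + 64 * (real n)\<^sup>2))"

definition theta :: "nat \<Rightarrow> real" where
  "theta k = real k / (real k + 5)"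

definition gam :: "nat \<Rightarrow> real" where
  "gam k = real k / (real k + 3)"

definition eta :: "real \<Rightarrow> nat \<Rightarrow> real" where
  "eta \<beta> k = 2 * \<beta> * (real k + 3) / (real k + 5)"

definition psi :: "nat \<Rightarrow> nat \<Rightarrow> real" where
  "psi n b = 64 * (real n)\<^sup>2 / (64 * (real n)\<^sup>2 + real b ^ 3)"

definition C0 :: "nat \<Rightarrow> nat \<Rightarrow> real \<Rightarrow> real" where
  "C0 n b L = 3 * (10 + 24 * L\<^sup>2 * (beta n b L)\<^sup>2)"

definition C1 :: "nat \<Rightarrow> nat \<Rightarrow> real \<Rightarrow> real" where
  "C1 n b L = 72 * L\<^sup>2 * (beta n b L)\<^sup>2 / 5 + (2 / 3 + psi n b) * C0 n b L"

definition C2 :: "nat \<Rightarrow> nat \<Rightarrow> real \<Rightarrow> real" where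
  "C2 n b L = 36 * L\<^sup>2 * (beta n b L)\<^sup>2 + (50 / 3 + psi n b) * C0 n b L + 100 * C1 n b L / 3"

definition C3 :: "nat \<Rightarrow> nat \<Rightarrow> real \<Rightarrow> real" where
  "C3 n b L = 25 * (C1 n b L + C2 n b L) / 18"


text \<open>
  A mini-batch drawn with replacement is a list of \<open>b\<close> indices, so that repeated indices count
  with multiplicity. Below, \<open>I k\<close> is the mini-batch and \<open>H k\<close> the set of refreshed table entries
  at iteration \<open>k\<close>, for one realization of the sampling; they are only used for \<open>k \<ge> 1\<close>.
  The convention \<open>x\<^sup>-\<^sup>1 = x\<^sup>0\<close> is obtained from truncated subtraction: \<open>x (k - 1)\<close> at \<open>k = 0\<close> is \<open>x 0\<close>.
\<close>

definition batch_avg :: "nat \<Rightarrow> nat list \<Rightarrow> (nat \<Rightarrow> real^'p) \<Rightarrow> real^'p" where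
  "batch_avg b I g = (1 / real b) *\<^sub>R (\<Sum>i\<leftarrow>I. g i)"

primrec saga_table ::
  "(nat \<Rightarrow> real^'p \<Rightarrow> real^'p) \<Rightarrow> (nat \<Rightarrow> nat set) \<Rightarrow> (nat \<Rightarrow> real^'p) \<Rightarrow> nat \<Rightarrow> nat \<Rightarrow> real^'p" where
  "saga_table G H x 0 = (\<lambda>i. G i (x 0))"
| "saga_table G H x (Suc k) = (\<lambda>i. if i \<in> H (Suc k) then G i (x k) else saga_table G H x k i)"

definition saga_estimator ::
  "nat \<Rightarrow> nat \<Rightarrow> (nat \<Rightarrow> real^'p \<Rightarrow> real^'p) \<Rightarrow> (nat \<Rightarrow> nat list) \<Rightarrow> (nat \<Rightarrow> nat set)
   \<Rightarrow> (nat \<Rightarrow> real^'p) \<Rightarrow> nat \<Rightarrow> real^'p" where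
  "saga_estimator n b G I H x k =
     (if k = 0 then avg_map n G (x k) - gam k *\<^sub>R avg_map n G (x (k - 1))
      else ((1 - gam k) / real n) *\<^sub>R (\<Sum>i\<in>{1..n}. saga_table G H x k i)
           + (batch_avg b (I k) (\<lambda>i. G i (x k))
              - gam k *\<^sub>R batch_avg b (I k) (\<lambda>i. G i (x (k - 1)))
              - (1 - gam k) *\<^sub>R batch_avg b (I k) (saga_table G H x k)))"

definition vfkm_saga_run ::
  "nat \<Rightarrow> nat \<Rightarrow> real \<Rightarrow> (nat \<Rightarrow> real^'p \<Rightarrow> real^'p) \<Rightarrow> real^'p
   \<Rightarrow> (nat \<Rightarrow> nat list) \<Rightarrow> (nat \<Rightarrow> nat set) \<Rightarrow> (nat \<Rightarrow> real^'p) \<Rightarrow> bool" where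
  "vfkm_saga_run n b L G x0 I H x \<longleftrightarrow>
     x 0 = x0 \<and>
     (\<forall>k. x (Suc k) = x k + theta k *\<^sub>R (x k - x (k - 1))
                      - eta (beta n b L) k *\<^sub>R saga_estimator n b G I H x k)"

text \<open>
  Number of evaluations of the \<open>G\<^sub>i\<close> spent to compute \<open>x\<^sup>K\<close>: the initial table costs \<open>n\<close> and
  also yields the estimator at iteration 0. Iteration \<open>k \<ge> 1\<close> evaluates the mini-batch at both
  \<open>x\<^sup>k\<close> and \<open>x\<^sup>k\<^sup>-\<^sup>1\<close>, and each refreshed table entry at \<open>x\<^sup>k\<^sup>-\<^sup>1\<close>.
\<close>

definition oracle_calls :: "nat \<Rightarrow> (nat \<Rightarrow> nat list) \<Rightarrow> (nat \<Rightarrow> nat set) \<Rightarrow> nat \<Rightarrow> nat" where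
  "oracle_calls n I H K = n + (\<Sum>k\<in>{1..<K}. 2 * length (I k) + card (H k))"


locale saga_sampling = prob_space M for M :: "'w measure" +
  fixes n b :: nat
    and I :: "nat \<Rightarrow> 'w \<Rightarrow> nat list"
    and H :: "nat \<Rightarrow> 'w \<Rightarrow> nat set"
  assumes batch_space:
      "\<And>k \<omega>. k \<ge> 1 \<Longrightarrow> \<omega> \<in> space M \<Longrightarrow> set (I k \<omega>) \<subseteq> {1..n} \<and> length (I k \<omega>) = b"
    and refresh_space:
      "\<And>k \<omega>. k \<ge> 1 \<Longrightarrow> \<omega> \<in> space M \<Longrightarrow> H k \<omega> \<subseteq> {1..n} \<and> card (H k \<omega>) = b"
    and fresh:
      "indep_vars (\<lambda>_. count_space UNIV) (\<lambda>k \<omega>. (I k \<omega>, H k \<omega>)) {1..}"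
    and law:
      "\<And>k. k \<ge> 1 \<Longrightarrow>
         distr M (count_space UNIV) (\<lambda>\<omega>. (I k \<omega>, H k \<omega>)) =
         measure_pmf (pair_pmf (replicate_pmf b (pmf_of_set {1..n}))
                               (pmf_of_set {A. A \<subseteq> {1..n} \<and> card A = b}))"

locale vfkm_saga = saga_sampling M n b I H
  for M :: "'w measure" and n b :: nat
    and I :: "nat \<Rightarrow> 'w \<Rightarrow> nat list" and H :: "nat \<Rightarrow> 'w \<Rightarrow> nat set" +
  fixes L :: real
    and G :: "nat \<Rightarrow> real^'p \<Rightarrow> real^'p"
    and x0 :: "real^'p"
    and x :: "nat \<Rightarrow> 'w \<Rightarrow> real^'p"
  assumes n_pos: "1 \<le> n"
    and L_pos: "0 < L"
    and zer_nonempty: "zer (avg_map n G) \<noteq> {}"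
    and cocoercive: "average_cocoercive n L G"
    and batch_size: "1 \<le> b" "real b \<le> min (real n) (4 * real n powr (2 / 3))"
    and run: "\<And>\<omega>. \<omega> \<in> space M \<Longrightarrow>
      vfkm_saga_run n b L G x0 (\<lambda>k. I k \<omega>) (\<lambda>k. H k \<omega>) (\<lambda>k. x k \<omega>)"

end

theory Submission
  imports Defs
begin

text \<open>
  Write \<open>g k\<close> for the operator at \<open>x k\<close>, \<open>e k\<close> for the error of the estimator, and
  \<open>v k = x k - x (k - 1) + 2 * \<beta> * g (k - 1)\<close>. With the given parameters the method reads
  \<open>(k + 5) * v (k + 1) = k * v k + 4 * \<beta> * g k - 2 * \<beta> * (k + 3) * e k\<close> and
  \<open>x (k + 1) = x k - 2 * \<beta> * g k + v (k + 1)\<close>. Hence the anchor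
  \<open>u k = 4 * (x k - xs) + k * v k\<close>, for a zero \<open>xs\<close>, changes in one step only by
  \<open>- 4 * \<beta> * g k - 2 * \<beta> * (k + 3) * e k\<close>. The square of its norm produces cross terms of
  \<open>g k\<close> with \<open>v k\<close>, which telescope once the potential
  \<open>(8 * \<beta> / 3) * k * (k + 4) * (\<beta> * norm (g (k - 1)) ^ 2 - g (k - 1) \<bullet> v k)\<close> is added. The
  resulting energy is nonnegative, and by cocoercivity it decreases by multiples of
  \<open>k * norm (g k) ^ 2\<close> and of \<open>k ^ 2\<close> times the mean squared move of the component maps, up to
  the noise \<open>4 * \<beta> ^ 2 * (k + 3) ^ 2 * norm (e k) ^ 2\<close> and a term of mean zero
  (lemmas \<open>energy_step\<close> and \<open>energy_lower\<close>).

  The variance of the estimator is controlled by the last move and by the staleness of the table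
  (\<open>err_variance\<close>), and the expected staleness contracts by the factor \<open>1 - b / (2 * n)\<close> up to a
  contribution of the last move (\<open>stale_recursion\<close>). A multiple of the staleness is therefore
  added to the expected energy; the factor \<open>1 - gam k = 3 / (k + 3)\<close> in front of the table keeps
  this multiple free of \<open>k\<close>, and the step size is so small that the moves are absorbed
  (\<open>noise_absorbed\<close>). So the Lyapunov function decreases (\<open>lyapunov_step\<close>) from
  \<open>16 * norm (x0 - xs) ^ 2\<close>. It bounds the anchor and \<open>k ^ 2 * norm (g (k - 1)) ^ 2\<close>; since
  \<open>x k\<close> is a convex combination of a step that does not move away from \<open>xs\<close> and of
  \<open>xs + u k / 4\<close>, the distance to \<open>xs\<close> and then the displacement are bounded too.

  The decrease also shows that the sum of \<open>k\<close> times the expected \<open>norm (g k) ^ 2\<close> and the sum of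
  the noise are finite. A second potential, quadratic in \<open>v k\<close> and \<open>g (k - 1)\<close> with weight
  \<open>k * (k + 4)\<close>, then decreases up to summable errors (\<open>momentum_step\<close>), and its quotients by
  \<open>k + 4\<close> are summable as well. Such a sequence tends to zero, because a positive limit would
  make the quotients sum like the harmonic series; this gives the limits.
\<close>

section \<open>Norms of sums and averages\<close>

lemma norm2_add_le_weighted:
  fixes a b :: "'v :: real_inner"
  assumes c: "c > 0"
  shows "(norm (a + b))\<^sup>2 \<le> (1 + 1 / c) * (norm a)\<^sup>2 + (1 + c) * (norm b)\<^sup>2"
proof -
  have "c * ((1 + 1 / c) * (norm a)\<^sup>2 + (1 + c) * (norm b)\<^sup>2 - (norm (a + b))\<^sup>2) = (norm (a - c *\<^sub>R b))\<^sup>2"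
    using c unfolding power2_norm_eq_inner by (simp add: inner_simps inner_commute algebra_simps)
  then have "0 \<le> c * ((1 + 1 / c) * (norm a)\<^sup>2 + (1 + c) * (norm b)\<^sup>2 - (norm (a + b))\<^sup>2)"
    by simp
  then show ?thesis
    using c by (simp add: zero_le_mult_iff)
qed

lemma norm2_add_le: "(norm (a + b))\<^sup>2 \<le> 2 * (norm a)\<^sup>2 + 2 * (norm b)\<^sup>2"
  for a b :: "'v :: real_inner"
  using norm2_add_le_weighted[of 1 a b] by simp

lemma norm2_add3_le: "(norm (p + q + r))\<^sup>2 \<le> 3 * ((norm p)\<^sup>2 + (norm q)\<^sup>2 + (norm r)\<^sup>2)"
  for p q r :: "'v :: real_inner"
proof -
  have "3 * ((norm p)\<^sup>2 + (norm q)\<^sup>2 + (norm r)\<^sup>2)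
      = (norm (p + q + r))\<^sup>2 + (norm (p - q))\<^sup>2 + (norm (q - r))\<^sup>2 + (norm (p - r))\<^sup>2"
    unfolding power2_norm_eq_inner by (simp add: inner_simps inner_commute)
  then show ?thesis by simp
qed

definition avg :: "nat \<Rightarrow> (nat \<Rightarrow> 'v :: real_vector) \<Rightarrow> 'v" where
  "avg n f = (1 / real n) *\<^sub>R (\<Sum>i\<in>{1..n}. f i)"

lemma avg_add: "avg n (\<lambda>i. f i + g i) = avg n f + avg n g"
  by (simp add: avg_def sum.distrib scaleR_add_right)

lemma avg_diff: "avg n (\<lambda>i. f i - g i) = avg n f - avg n g"
  by (simp add: avg_def sum_subtractf scaleR_diff_right)

lemma avg_scaleR: "avg n (\<lambda>i. c *\<^sub>R f i) = c *\<^sub>R avg n f"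
  by (simp add: avg_def scaleR_right.sum[symmetric])

lemma avg_mult: "avg n (\<lambda>i. c * f i) = c * avg n f" for c :: real
  by (simp add: avg_def sum_distrib_left[symmetric])

lemma avg_inner: "avg n (\<lambda>i. c \<bullet> f i) = c \<bullet> avg n f"
  by (simp add: avg_def inner_sum_right)

lemma avg_const: "n \<ge> 1 \<Longrightarrow> avg n (\<lambda>i. c) = c"
  by (simp add: avg_def sum_constant_scaleR)

lemma avg_mono: "(\<And>i. i \<in> {1..n} \<Longrightarrow> f i \<le> g i) \<Longrightarrow> avg n f \<le> avg n g" for f g :: "nat \<Rightarrow> real"
  by (auto simp: avg_def intro!: divide_right_mono sum_mono)

lemma avg_nonneg: "(\<And>i. i \<in> {1..n} \<Longrightarrow> 0 \<le> f i) \<Longrightarrow> 0 \<le> avg n f" for f :: "nat \<Rightarrow> real"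
  by (auto simp: avg_def intro!: divide_nonneg_nonneg sum_nonneg)

lemma avg_norm2_centered:
  fixes f :: "nat \<Rightarrow> 'v :: real_inner"
  assumes "n \<ge> 1"
  shows "avg n (\<lambda>i. (norm (f i - avg n f))\<^sup>2) = avg n (\<lambda>i. (norm (f i))\<^sup>2) - (norm (avg n f))\<^sup>2"
proof -
  have "(norm (f i - avg n f))\<^sup>2
      = ((norm (f i))\<^sup>2 - 2 * (avg n f \<bullet> f i)) + (norm (avg n f))\<^sup>2" for i
    by (simp add: power2_norm_eq_inner inner_simps inner_commute)
  then show ?thesis
    using assms by (simp add: avg_add avg_diff avg_mult avg_inner avg_const power2_norm_eq_inner)
qed

lemma norm2_avg_le:
  fixes f :: "nat \<Rightarrow> 'v :: real_inner"
  assumes "n \<ge> 1"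
  shows "(norm (avg n f))\<^sup>2 \<le> avg n (\<lambda>i. (norm (f i))\<^sup>2)"
  using avg_norm2_centered[OF assms, of f] avg_nonneg[of n "\<lambda>i. (norm (f i - avg n f))\<^sup>2"] by simp

section \<open>Mini-batches and random subsets\<close>

lemma expectation_bind_finite:
  fixes h :: "'b \<Rightarrow> real"
  assumes "finite (set_pmf p)" and "\<And>x. finite (set_pmf (f x))"
  shows "measure_pmf.expectation (p \<bind> f) h
       = measure_pmf.expectation p (\<lambda>x. measure_pmf.expectation (f x) h)"
  using assms
  by (simp add: pmf_expectation_bind[where A = "set_pmf p"] integral_measure_pmf[where A = "set_pmf p"])

lemma expectation_pair_finite:
  fixes h :: "'a \<times> 'b \<Rightarrow> real"
  assumes "finite (set_pmf p)" and "finite (set_pmf q)"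
  shows "measure_pmf.expectation (pair_pmf p q) h
       = measure_pmf.expectation q (\<lambda>y. measure_pmf.expectation p (\<lambda>x. h (x, y)))"
proof -
  have "pair_pmf p q = q \<bind> (\<lambda>y. map_pmf (\<lambda>x. (x, y)) p)"
    unfolding pair_pmf_def map_pmf_def by (rule bind_commute_pmf)
  then show ?thesis
    using assms by (simp add: expectation_bind_finite)
qed

lemma finite_set_replicate_pmf:
  "finite (set_pmf p) \<Longrightarrow> finite (set_pmf (replicate_pmf m p))"
  using finite_lists_length_eq[of "set_pmf p" m]
  by (simp add: set_replicate_pmf lists_eq_set conj_commute)

lemma expectation_replicate_Suc:
  fixes h :: "'a list \<Rightarrow> real"
  assumes "finite (set_pmf p)"
  shows "measure_pmf.expectation (replicate_pmf (Suc m) p) h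
       = measure_pmf.expectation p
           (\<lambda>i. measure_pmf.expectation (replicate_pmf m p) (\<lambda>J. h (i # J)))"
  using assms by (simp add: expectation_bind_finite finite_set_replicate_pmf)

lemma expectation_batch_sum:
  fixes f :: "'a \<Rightarrow> real"
  assumes fin: "finite (set_pmf p)"
  shows "measure_pmf.expectation (replicate_pmf m p) (\<lambda>J. \<Sum>i\<leftarrow>J. f i)
       = real m * measure_pmf.expectation p f"
proof (induction m)
  case (Suc m)
  note int = integrable_measure_pmf_finite[OF finite_set_replicate_pmf[OF fin]]
    integrable_measure_pmf_finite[OF fin]
  show ?case
    unfolding expectation_replicate_Suc[OF fin]
    by (simp add: Suc.IH int algebra_simps del: replicate_pmf.simps)
qed simp

text \<open>
  Independent centered draws are orthogonal in mean, so the second moment of their sum is the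
  sum of the second moments; this is where a mini-batch gains its factor.
\<close>
lemma expectation_batch_sum_norm2:
  fixes g :: "'a \<Rightarrow> 'v :: euclidean_space"
  assumes fin: "finite (set_pmf p)"
    and centered: "\<And>c. measure_pmf.expectation p (\<lambda>i. c \<bullet> g i) = 0"
  shows "measure_pmf.expectation (replicate_pmf m p) (\<lambda>J. (norm (\<Sum>i\<leftarrow>J. g i))\<^sup>2)
       = real m * measure_pmf.expectation p (\<lambda>i. (norm (g i))\<^sup>2)"
proof (induction m)
  case (Suc m)
  note int = integrable_measure_pmf_finite[OF finite_set_replicate_pmf[OF fin]]
    integrable_measure_pmf_finite[OF fin]
  have inner_sum: "c \<bullet> (\<Sum>i\<leftarrow>J. g i) = (\<Sum>i\<leftarrow>J. c \<bullet> g i)" for c J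
    by (induction J) (simp_all add: inner_add_right)
  have cross: "measure_pmf.expectation (replicate_pmf m p) (\<lambda>J. g i \<bullet> (\<Sum>j\<leftarrow>J. g j)) = 0" for i
    unfolding inner_sum by (subst expectation_batch_sum[OF fin]) (simp add: centered)
  have split: "(norm (\<Sum>j\<leftarrow>i # J. g j))\<^sup>2
      = (norm (g i))\<^sup>2 + 2 * (g i \<bullet> (\<Sum>j\<leftarrow>J. g j)) + (norm (\<Sum>j\<leftarrow>J. g j))\<^sup>2" for i J
    by (simp add: power2_norm_eq_inner inner_simps inner_commute)
  show ?case
    unfolding expectation_replicate_Suc[OF fin] split
    by (simp add: Suc.IH cross int algebra_simps del: replicate_pmf.simps)
qed simp

abbreviation uniform_batch :: "nat \<Rightarrow> nat \<Rightarrow> nat list pmf" where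
  "uniform_batch n b \<equiv> replicate_pmf b (pmf_of_set {1..n})"

abbreviation uniform_subset :: "nat \<Rightarrow> nat \<Rightarrow> nat set pmf" where
  "uniform_subset n b \<equiv> pmf_of_set {A. A \<subseteq> {1..n} \<and> card A = b}"

lemma expectation_uniform:
  fixes f :: "nat \<Rightarrow> real"
  shows "n \<ge> 1 \<Longrightarrow> measure_pmf.expectation (pmf_of_set {1..n}) f = avg n f"
  by (subst integral_pmf_of_set) (auto simp: avg_def)

lemma batch_avg_inner: "c \<bullet> batch_avg b J g = (1 / real b) * (\<Sum>i\<leftarrow>J. c \<bullet> g i)"
proof -
  have "c \<bullet> (\<Sum>i\<leftarrow>J. g i) = (\<Sum>i\<leftarrow>J. c \<bullet> g i)"
    by (induction J) (simp_all add: inner_add_right)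
  then show ?thesis by (simp add: batch_avg_def)
qed

lemma batch_avg_diff: "batch_avg b J (\<lambda>i. f i - g i) = batch_avg b J f - batch_avg b J g"
  by (induction J) (simp_all add: batch_avg_def algebra_simps)

lemma batch_avg_scaleR: "batch_avg b J (\<lambda>i. c *\<^sub>R f i) = c *\<^sub>R batch_avg b J f"
  by (induction J) (simp_all add: batch_avg_def algebra_simps)

lemma batch_avg_unbiased:
  assumes "n \<ge> 1" "b \<ge> 1"
  shows "measure_pmf.expectation (uniform_batch n b) (\<lambda>J. c \<bullet> batch_avg b J g) = c \<bullet> avg n g"
  unfolding batch_avg_inner using assms
  by (simp add: expectation_batch_sum expectation_uniform avg_inner del: One_nat_def)

text \<open>
  The variance of a batch mean is that of one draw divided by \<open>b\<close>, and the variance of one draw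
  is at most its second moment.
\<close>
lemma batch_avg_variance:
  assumes n: "n \<ge> 1" and b: "b \<ge> 1"
  shows "measure_pmf.expectation (uniform_batch n b) (\<lambda>J. (norm (batch_avg b J g - avg n g))\<^sup>2)
       \<le> (1 / real b) * avg n (\<lambda>i. (norm (g i))\<^sup>2)"
proof -
  define h where "h = (\<lambda>i. g i - avg n g)"
  have fin: "finite (set_pmf (pmf_of_set {1..n}))"
    using n by simp
  have centered: "measure_pmf.expectation (pmf_of_set {1..n}) (\<lambda>i. c \<bullet> h i) = 0" for c
    using n by (simp add: expectation_uniform avg_inner h_def avg_diff avg_const del: One_nat_def)
  have sum_h: "(\<Sum>i\<leftarrow>J. h i) = (\<Sum>i\<leftarrow>J. g i) - real (length J) *\<^sub>R avg n g" for J
    by (induction J) (simp_all add: h_def algebra_simps)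
  have dev: "batch_avg b J g - avg n g = (1 / real b) *\<^sub>R (\<Sum>i\<leftarrow>J. h i)"
    if "J \<in> set_pmf (uniform_batch n b)" for J
    using that b by (simp add: sum_h batch_avg_def set_replicate_pmf scaleR_diff_right)
  have "measure_pmf.expectation (uniform_batch n b) (\<lambda>J. (norm (batch_avg b J g - avg n g))\<^sup>2)
      = measure_pmf.expectation (uniform_batch n b) (\<lambda>J. (1 / real b)\<^sup>2 * (norm (\<Sum>i\<leftarrow>J. h i))\<^sup>2)"
    by (intro integral_cong_AE)
      (auto simp: AE_measure_pmf_iff dev power_mult_distrib power_divide)
  also have "\<dots> = (1 / real b)\<^sup>2 * (real b * avg n (\<lambda>i. (norm (h i))\<^sup>2))"
    using expectation_batch_sum_norm2[OF fin centered, of b] n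
    by (simp add: expectation_uniform del: One_nat_def)
  also have "\<dots> = (1 / real b) * avg n (\<lambda>i. (norm (h i))\<^sup>2)"
    using b by (simp add: power2_eq_square)
  also have "\<dots> \<le> (1 / real b) * avg n (\<lambda>i. (norm (g i))\<^sup>2)"
    unfolding h_def avg_norm2_centered[OF n] using b by (intro mult_left_mono) auto
  finally show ?thesis .
qed

text \<open>
  A fixed index avoids a random \<open>b\<close>-subset with probability \<open>1 - b / n\<close>, because the subsets
  that avoid it are the \<open>b\<close>-subsets of a set with \<open>n - 1\<close> elements.
\<close>
lemma expectation_not_refreshed:
  fixes c :: "nat \<Rightarrow> real"
  assumes n: "n \<ge> 1" and b: "b \<le> n"
  shows "measure_pmf.expectation (uniform_subset n b) (\<lambda>A. avg n (\<lambda>i. if i \<in> A then 0 else c i))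
       = (1 - real b / real n) * avg n c"
proof -
  let ?S = "{A. A \<subseteq> {1..n} \<and> card A = b}"
  have fin: "finite ?S"
    by (rule finite_subset[of _ "Pow {1..n}"]) auto
  have card_S: "card ?S = n choose b"
    by (simp add: n_subsets)
  have pos: "(n choose b) > 0"
    using b by simp
  have ne: "?S \<noteq> {}"
    using card_S pos fin by (metis card.empty less_irrefl)
  have avoid: "card {A \<in> ?S. i \<notin> A} = (n - 1) choose b" if "i \<in> {1..n}" for i
  proof -
    have "{A \<in> ?S. i \<notin> A} = {A. A \<subseteq> {1..n} - {i} \<and> card A = b}"
      by auto
    then show ?thesis
      using that by (simp add: n_subsets)
  qed
  have "real ((n - b) * (n choose b)) = real (n * ((n - 1) choose b))"
    using binomial_absorb_comp[of n b] by presburger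
  then have absorb: "real ((n - 1) choose b) = (1 - real b / real n) * real (n choose b)"
    using n b by (simp add: field_simps of_nat_diff)
  have single: "(\<Sum>A\<in>?S. if i \<in> A then 0 else c i) = (1 - real b / real n) * real (n choose b) * c i"
    if "i \<in> {1..n}" for i
  proof -
    have "(\<Sum>A\<in>?S. if i \<in> A then 0 else c i) = (\<Sum>A\<in>{A \<in> ?S. i \<notin> A}. c i)"
      using fin by (intro sum.mono_neutral_cong_right) auto
    also have "\<dots> = real ((n - 1) choose b) * c i"
      using avoid[OF that] by simp
    finally show ?thesis
      using absorb by simp
  qed
  have "(\<Sum>A\<in>?S. avg n (\<lambda>i. if i \<in> A then 0 else c i))
      = (1 / real n) * (\<Sum>i\<in>{1..n}. \<Sum>A\<in>?S. if i \<in> A then 0 else c i)"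
    unfolding avg_def real_scaleR_def sum_distrib_left[symmetric]
    by (rule arg_cong[OF sum.swap])
  also have "(\<Sum>i\<in>{1..n}. \<Sum>A\<in>?S. if i \<in> A then 0 else c i)
      = (\<Sum>i\<in>{1..n}. (1 - real b / real n) * real (n choose b) * c i)"
    by (intro sum.cong refl single)
  also have "(1 / real n) * \<dots> = real (n choose b) * ((1 - real b / real n) * avg n c)"
    by (simp add: avg_def sum_distrib_left mult_ac)
  finally show ?thesis
    unfolding integral_pmf_of_set[OF ne fin] card_S using pos by simp
qed

section \<open>Random variables determined by finitely many samples\<close>

text \<open>
  Sets of indices form an uncountable type, so histories of samples are handled through the level
  sets of the finitely many values that occur and not as points of a product measure space.
\<close>
lemma (in prob_space) finite_range_expectation:
  fixes f :: "'c \<Rightarrow> real"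
  assumes S: "finite S" and X: "\<And>\<omega>. \<omega> \<in> space M \<Longrightarrow> X \<omega> \<in> S"
    and ev: "\<And>s. s \<in> S \<Longrightarrow> {\<omega> \<in> space M. X \<omega> = s} \<in> events"
  shows "integrable M (\<lambda>\<omega>. f (X \<omega>))"
    and "expectation (\<lambda>\<omega>. f (X \<omega>)) = (\<Sum>s\<in>S. f s * prob {\<omega> \<in> space M. X \<omega> = s})"
proof -
  let ?A = "\<lambda>s. {\<omega> \<in> space M. X \<omega> = s}"
  have step: "f (X \<omega>) = (\<Sum>s\<in>S. f s * indicator (?A s) \<omega>)" if "\<omega> \<in> space M" for \<omega>
    using that S X[OF that] by (simp add: indicator_def if_distrib[of "(*) _"] cong: if_cong)
  have int: "integrable M (\<lambda>\<omega>. f s * indicator (?A s) \<omega>)" if "s \<in> S" for s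
    using ev[OF that] by (intro integrable_mult_right integrable_real_indicator)
      (auto simp: emeasure_eq_measure)
  have "integrable M (\<lambda>\<omega>. \<Sum>s\<in>S. f s * indicator (?A s) \<omega>)"
    by (intro Bochner_Integration.integrable_sum int)
  then show "integrable M (\<lambda>\<omega>. f (X \<omega>))"
    by (subst Bochner_Integration.integrable_cong[OF refl step]) auto
  have "expectation (\<lambda>\<omega>. f (X \<omega>)) = expectation (\<lambda>\<omega>. \<Sum>s\<in>S. f s * indicator (?A s) \<omega>)"
    by (rule Bochner_Integration.integral_cong[OF refl step])
  also have "\<dots> = (\<Sum>s\<in>S. expectation (\<lambda>\<omega>. f s * indicator (?A s) \<omega>))"
    by (intro Bochner_Integration.integral_sum int)
  also have "\<dots> = (\<Sum>s\<in>S. f s * prob (?A s))"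
    using ev by (intro sum.cong refl) (simp add: Int_absorb1 Collect_conj_eq)
  finally show "expectation (\<lambda>\<omega>. f (X \<omega>)) = (\<Sum>s\<in>S. f s * prob (?A s))" .
qed

context saga_sampling
begin

abbreviation sample :: "nat \<Rightarrow> 'w \<Rightarrow> nat list \<times> nat set" where
  "sample k \<omega> \<equiv> (I k \<omega>, H k \<omega>)"

definition sample_values :: "(nat list \<times> nat set) set" where
  "sample_values = {J. set J \<subseteq> {1..n} \<and> length J = b} \<times> Pow {1..n}"

definition hist :: "nat \<Rightarrow> 'w \<Rightarrow> (nat list \<times> nat set) list" where
  "hist m \<omega> = map (\<lambda>j. sample j \<omega>) [1..<Suc m]"

definition histories :: "nat \<Rightarrow> (nat list \<times> nat set) list set" where
  "histories m = {h. set h \<subseteq> sample_values \<and> length h = m}"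

abbreviation sample_law :: "(nat list \<times> nat set) pmf" where
  "sample_law \<equiv> pair_pmf (uniform_batch n b) (uniform_subset n b)"

text \<open>
  Dependence on the first \<open>m\<close> samples is expressed by comparing outcomes instead of by
  measurability with respect to a sub-\<open>\<sigma>\<close>-algebra. As the samples take finitely many values, the
  two agree for real-valued variables, and this form is verified by rewriting.
\<close>
definition determined :: "nat \<Rightarrow> ('w \<Rightarrow> 'c) \<Rightarrow> bool" where
  "determined m Y \<longleftrightarrow>
     (\<forall>\<omega>\<in>space M. \<forall>\<omega>'\<in>space M. (\<forall>j\<in>{1..m}. sample j \<omega> = sample j \<omega>') \<longrightarrow> Y \<omega> = Y \<omega>')"

lemma determined_mono: "determined m Y \<Longrightarrow> m \<le> m' \<Longrightarrow> determined m' Y"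
  unfolding determined_def by (meson atLeastAtMost_iff le_trans)

lemma determined_comp: "determined m X \<Longrightarrow> determined m (\<lambda>\<omega>. f (X \<omega>))"
  unfolding determined_def by metis

lemma determined_comp2: "determined m X \<Longrightarrow> determined m Y \<Longrightarrow> determined m (\<lambda>\<omega>. f (X \<omega>) (Y \<omega>))"
  unfolding determined_def by metis

lemma determined_factors:
  assumes "determined m Y"
  obtains F where "\<And>\<omega>. \<omega> \<in> space M \<Longrightarrow> Y \<omega> = F (hist m \<omega>)"
proof
  fix \<omega> assume \<omega>: "\<omega> \<in> space M"
  define \<omega>' where "\<omega>' = (SOME \<omega>'. \<omega>' \<in> space M \<and> hist m \<omega>' = hist m \<omega>)"
  have *: "\<omega>' \<in> space M \<and> hist m \<omega>' = hist m \<omega>"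
    unfolding \<omega>'_def by (rule someI[where x = \<omega>]) (simp add: \<omega>)
  then have "\<forall>j\<in>{1..m}. sample j \<omega>' = sample j \<omega>"
    by (auto simp: hist_def)
  then have "Y \<omega>' = Y \<omega>"
    using assms * \<omega> unfolding determined_def by blast
  then show "Y \<omega> = (\<lambda>h. Y (SOME \<omega>'. \<omega>' \<in> space M \<and> hist m \<omega>' = h)) (hist m \<omega>)"
    by (simp add: \<omega>'_def)
qed

lemma finite_sample_values: "finite sample_values"
  unfolding sample_values_def by (intro finite_cartesian_product finite_lists_length_eq) auto

lemma finite_histories: "finite (histories m)"
  unfolding histories_def by (intro finite_lists_length_eq finite_sample_values)

lemma sample_in_values: "\<omega> \<in> space M \<Longrightarrow> k \<ge> 1 \<Longrightarrow> sample k \<omega> \<in> sample_values"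
  using batch_space refresh_space by (auto simp: sample_values_def)

lemma hist_in_histories: "\<omega> \<in> space M \<Longrightarrow> hist m \<omega> \<in> histories m"
  using sample_in_values by (auto simp: hist_def histories_def)

lemma sample_measurable: "k \<ge> 1 \<Longrightarrow> sample k \<in> M \<rightarrow>\<^sub>M count_space UNIV"
  using fresh by (auto simp: indep_vars_def)

lemma sample_event: "k \<ge> 1 \<Longrightarrow> {\<omega> \<in> space M. sample k \<omega> = z} \<in> events"
proof -
  assume "k \<ge> 1"
  then have "sample k -` {z} \<inter> space M \<in> events"
    using sample_measurable by (intro measurable_sets[where A = "count_space UNIV"]) auto
  moreover have "sample k -` {z} \<inter> space M = {\<omega> \<in> space M. sample k \<omega> = z}"
    by auto
  ultimately show ?thesis by simp
qed

lemma sample_prob: "k \<ge> 1 \<Longrightarrow> prob {\<omega> \<in> space M. sample k \<omega> = z} = pmf sample_law z"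
proof -
  assume k: "k \<ge> 1"
  have "prob (sample k -` {z} \<inter> space M) = measure (distr M (count_space UNIV) (sample k)) {z}"
    using sample_measurable[OF k] by (subst measure_distr) auto
  also have "\<dots> = pmf sample_law z"
    unfolding law[OF k] by (simp add: measure_pmf_single)
  moreover have "sample k -` {z} \<inter> space M = {\<omega> \<in> space M. sample k \<omega> = z}"
    by auto
  ultimately show ?thesis by simp
qed

lemma hist_eq_iff:
  assumes "length h = m"
  shows "hist m \<omega> = h \<longleftrightarrow> (\<forall>j\<in>{1..m}. sample j \<omega> = h ! (j - 1))"
proof -
  have "hist m \<omega> = h \<longleftrightarrow> (\<forall>i<m. sample (Suc i) \<omega> = h ! i)"
    using assms by (auto simp: list_eq_iff_nth_eq hist_def simp del: upt_Suc)
  also have "\<dots> \<longleftrightarrow> (\<forall>j\<in>{1..m}. sample j \<omega> = h ! (j - 1))"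
  proof (intro iffI ballI allI impI)
    fix j assume *: "\<forall>i<m. sample (Suc i) \<omega> = h ! i" and "j \<in> {1..m}"
    then have "j - 1 < m" "Suc (j - 1) = j"
      by auto
    then show "sample j \<omega> = h ! (j - 1)"
      using * by metis
  next
    fix i assume *: "\<forall>j\<in>{1..m}. sample j \<omega> = h ! (j - 1)" and "i < m"
    then show "sample (Suc i) \<omega> = h ! i"
      using bspec[OF *, of "Suc i"] by simp
  qed
  finally show ?thesis .
qed

lemma hist_event: "h \<in> histories m \<Longrightarrow> {\<omega> \<in> space M. hist m \<omega> = h} \<in> events"
proof -
  assume "h \<in> histories m"
  then have "{\<omega> \<in> space M. hist m \<omega> = h}
      = {\<omega> \<in> space M. \<forall>j\<in>{1..m}. sample j \<omega> = h ! (j - 1)}"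
    by (simp add: hist_eq_iff histories_def)
  also have "\<dots> \<in> events"
    by (intro sets.sets_Collect_finite_All sample_event) auto
  finally show ?thesis .
qed

lemma hist_sample_indep:
  assumes h: "h \<in> histories m"
  shows "prob {\<omega> \<in> space M. hist m \<omega> = h \<and> sample (Suc m) \<omega> = z}
       = prob {\<omega> \<in> space M. hist m \<omega> = h} * prob {\<omega> \<in> space M. sample (Suc m) \<omega> = z}"
proof (cases "m = 0")
  case True
  then have "hist m \<omega> = h" for \<omega>
    using h by (simp add: hist_def histories_def)
  then show ?thesis by (simp add: prob_space)
next
  case False
  define A where "A = (\<lambda>j. if j = Suc m then {z} else {h ! (j - 1)})"
  have len: "length h = m"
    using h by (simp add: histories_def)
  let ?E = "\<lambda>j. sample j -` A j \<inter> space M"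
  have "prob (\<Inter>j\<in>{1..Suc m}. ?E j) = (\<Prod>j\<in>{1..Suc m}. prob (?E j))"
    using indep_varsD[OF fresh, of "{1..Suc m}" A] by auto
  also have "\<dots> = (\<Prod>j\<in>{1..m}. prob (?E j)) * prob (?E (Suc m))"
    by simp
  also have "(\<Prod>j\<in>{1..m}. prob (?E j)) = prob (\<Inter>j\<in>{1..m}. ?E j)"
    using indep_varsD[OF fresh, of "{1..m}" A] False by auto
  finally have indep: "prob (\<Inter>j\<in>{1..Suc m}. ?E j) = prob (\<Inter>j\<in>{1..m}. ?E j) * prob (?E (Suc m))" .
  have "(\<Inter>j\<in>{1..m}. ?E j) = {\<omega> \<in> space M. hist m \<omega> = h}"
    using False unfolding hist_eq_iff[OF len] by (auto simp: A_def)
  moreover have "?E (Suc m) = {\<omega> \<in> space M. sample (Suc m) \<omega> = z}"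
    by (auto simp: A_def)
  moreover have "(\<Inter>j\<in>{1..Suc m}. ?E j) = (\<Inter>j\<in>{1..m}. ?E j) \<inter> ?E (Suc m)"
    by (auto simp: atLeastAtMostSuc_conv)
  ultimately show ?thesis
    using indep by (simp add: Collect_conj_eq Int_ac)
qed

lemma integrable_determined:
  fixes Y :: "'w \<Rightarrow> real"
  assumes "determined m Y"
  shows "integrable M Y"
proof -
  obtain F where F: "\<And>\<omega>. \<omega> \<in> space M \<Longrightarrow> Y \<omega> = F (hist m \<omega>)"
    using determined_factors[OF assms] by blast
  have "integrable M (\<lambda>\<omega>. F (hist m \<omega>))"
    by (rule finite_range_expectation(1)[OF finite_histories]) (auto intro: hist_in_histories hist_event)
  then show ?thesis
    by (subst Bochner_Integration.integrable_cong[OF refl F]) auto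
qed

text \<open>
  The next sample is independent of the past, so it can be averaged out first with the past held
  fixed. This is the form in which conditional expectations given the past are used.
\<close>
lemma expectation_fresh_sample:
  fixes f :: "'w \<Rightarrow> nat list \<times> nat set \<Rightarrow> real"
  assumes det: "determined m f"
  shows "expectation (\<lambda>\<omega>. f \<omega> (sample (Suc m) \<omega>))
       = expectation (\<lambda>\<omega>. measure_pmf.expectation sample_law (f \<omega>))"
proof -
  obtain F where F: "\<And>\<omega>. \<omega> \<in> space M \<Longrightarrow> f \<omega> = F (hist m \<omega>)"
    using determined_factors[OF det] by blast
  let ?P = "\<lambda>h. prob {\<omega> \<in> space M. hist m \<omega> = h}"
  let ?X = "\<lambda>\<omega>. (hist m \<omega>, sample (Suc m) \<omega>)"
  have ev: "{\<omega> \<in> space M. ?X \<omega> = s} \<in> events" if "s \<in> histories m \<times> sample_values" for s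
  proof -
    have "{\<omega> \<in> space M. ?X \<omega> = s}
        = {\<omega> \<in> space M. hist m \<omega> = fst s} \<inter> {\<omega> \<in> space M. sample (Suc m) \<omega> = snd s}"
      by auto
    then show ?thesis
      using that hist_event[of "fst s" m] sample_event[of "Suc m" "snd s"] by auto
  qed
  have supp: "z \<in> sample_values" if "z \<in> set_pmf sample_law" for z
  proof (rule ccontr)
    assume "z \<notin> sample_values"
    then have none: "{\<omega> \<in> space M. sample 1 \<omega> = z} = {}"
      using sample_in_values[of _ 1] by auto
    have "pmf sample_law z = 0"
      using sample_prob[of 1 z] unfolding none by simp
    with that show False
      unfolding pmf_eq_0_set_pmf by contradiction
  qed
  have inner: "measure_pmf.expectation sample_law (F h) = (\<Sum>z\<in>sample_values. F h z * pmf sample_law z)" for h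
    using supp by (intro integral_measure_pmf_real finite_sample_values)
  have "expectation (\<lambda>\<omega>. f \<omega> (sample (Suc m) \<omega>)) = expectation (\<lambda>\<omega>. case_prod F (?X \<omega>))"
    by (intro Bochner_Integration.integral_cong) (auto simp: F)
  also have "\<dots> = (\<Sum>s\<in>histories m \<times> sample_values. case_prod F s * prob {\<omega> \<in> space M. ?X \<omega> = s})"
    using ev hist_in_histories sample_in_values
    by (intro finite_range_expectation(2) finite_cartesian_product finite_histories
        finite_sample_values) auto
  also have "\<dots> = (\<Sum>h\<in>histories m. \<Sum>z\<in>sample_values. F h z * (?P h * pmf sample_law z))"
    unfolding sum.cartesian_product
  proof (intro sum.cong refl)
    fix s assume "s \<in> histories m \<times> sample_values"
    then have h: "fst s \<in> histories m"
      by auto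
    have "{\<omega> \<in> space M. ?X \<omega> = s} = {\<omega> \<in> space M. hist m \<omega> = fst s \<and> sample (Suc m) \<omega> = snd s}"
      by (cases s) auto
    then have "prob {\<omega> \<in> space M. ?X \<omega> = s} = ?P (fst s) * pmf sample_law (snd s)"
      using hist_sample_indep[OF h, of "snd s"] sample_prob[of "Suc m" "snd s"]
      by (simp only: le_add1 One_nat_def Suc_le_mono zero_le)
    then show "case_prod F s * prob {\<omega> \<in> space M. ?X \<omega> = s}
        = (case s of (h, z) \<Rightarrow> F h z * (?P h * pmf sample_law z))"
      by (cases s) simp
  qed
  also have "\<dots> = (\<Sum>h\<in>histories m. measure_pmf.expectation sample_law (F h) * ?P h)"
    unfolding inner by (simp add: sum_distrib_left sum_distrib_right mult_ac)
  also have "\<dots> = expectation (\<lambda>\<omega>. measure_pmf.expectation sample_law (F (hist m \<omega>)))"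
    by (rule finite_range_expectation(2)[OF finite_histories, symmetric])
      (auto intro: hist_in_histories hist_event)
  also have "\<dots> = expectation (\<lambda>\<omega>. measure_pmf.expectation sample_law (f \<omega>))"
    by (intro Bochner_Integration.integral_cong) (auto simp: F)
  finally show ?thesis .
qed

end

section \<open>The energy inequality for one step\<close>

text \<open>
  The weight 4 is the one for which displacement and velocity cancel in a step of the method, so
  that the anchor changes only by multiples of the current operator value and of the error.
\<close>
definition anchor :: "real \<Rightarrow> 'v :: real_inner \<Rightarrow> 'v \<Rightarrow> 'v" where
  "anchor k X v = 4 *\<^sub>R X + k *\<^sub>R v"

text \<open>
  Here \<open>h\<close> is the operator value at the previous iterate. The second summand is the potential
  whose differences cancel the cross terms of operator value and velocity in the squared anchor.
\<close>
definition energy :: "real \<Rightarrow> real \<Rightarrow> 'v :: real_inner \<Rightarrow> 'v \<Rightarrow> 'v \<Rightarrow> real" where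
  "energy \<beta> k X v h = (norm (anchor k X v))\<^sup>2
     + 8 * \<beta> / 3 * (k * (k + 4)) * (\<beta> * (norm h)\<^sup>2 - h \<bullet> v)"

text \<open>
  The vectors are: \<open>X\<close> and \<open>X'\<close> the two iterates relative to a zero, \<open>d\<close> the last displacement,
  \<open>h\<close> and \<open>g\<close> the previous and current operator values, \<open>v\<close> and \<open>v'\<close> the velocities, \<open>e\<close> the
  estimation error; \<open>A\<close> is the mean squared move of the component maps. The computation is an
  identity up to the two uses of cocoercivity, and \<open>e\<close> enters linearly only through a vector
  \<open>c\<close> that is known before the sampling.
\<close>
lemma energy_step:
  fixes X v g h d e v' X' :: "'v :: real_inner"
  assumes k: "k \<ge> 0" and \<beta>: "\<beta> > 0" and L: "L > 0" and \<beta>L: "4 * \<beta> * L \<le> 1"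
    and v: "v = d + (2 * \<beta>) *\<^sub>R h"
    and v': "(k + 5) *\<^sub>R v' = k *\<^sub>R v + (4 * \<beta>) *\<^sub>R g - (2 * \<beta> * (k + 3)) *\<^sub>R e"
    and X': "X' = X - (2 * \<beta>) *\<^sub>R g + v'"
    and mono: "g \<bullet> X \<ge> (1 / L) * (norm g)\<^sup>2"
    and coco: "(g - h) \<bullet> d \<ge> (1 / L) * A" and A: "A \<ge> (norm (g - h))\<^sup>2"
  defines "c \<equiv> (16 * \<beta>\<^sup>2 / 3 * (k + 1) * (k + 3)) *\<^sub>R g - (4 * \<beta> * (k + 3)) *\<^sub>R (anchor k X v - (4 * \<beta>) *\<^sub>R g)"
  shows "energy \<beta> (k + 1) X' v' g \<le> energy \<beta> k X v h - 16 / 3 * \<beta>\<^sup>2 * (k + 1) * (norm g)\<^sup>2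
     - 2 * \<beta> / L * (k * (k + 4)) * A + 4 * \<beta>\<^sup>2 * (k + 3)\<^sup>2 * (norm e)\<^sup>2 + c \<bullet> e"
proof -
  define q where "q = h \<bullet> v - \<beta> * (norm h)\<^sup>2"
  define p where "p = g \<bullet> v - \<beta> * (norm g)\<^sup>2"
  define u where "u = anchor k X v"
  have five: "(k + 5) *\<^sub>R v' = 4 *\<^sub>R v' + (k + 1) *\<^sub>R v'"
    by (simp flip: scaleR_add_left)
  have "anchor (k + 1) X' v' = 4 *\<^sub>R X - (8 * \<beta>) *\<^sub>R g + (k + 5) *\<^sub>R v'"
    unfolding anchor_def X' five by (simp add: algebra_simps)
  also have "\<dots> = u - (4 * \<beta>) *\<^sub>R g - (2 * \<beta> * (k + 3)) *\<^sub>R e"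
    unfolding v' by (simp add: u_def anchor_def algebra_simps flip: scaleR_add_left)
  finally have anchor': "anchor (k + 1) X' v' = u - (4 * \<beta>) *\<^sub>R g - (2 * \<beta> * (k + 3)) *\<^sub>R e" .
  have gu: "g \<bullet> u = 4 * (g \<bullet> X) + k * (g \<bullet> v)"
    by (simp add: u_def anchor_def inner_simps)
  have gv': "(k + 5) * (g \<bullet> v') = k * (g \<bullet> v) + 4 * \<beta> * (norm g)\<^sup>2 - 2 * \<beta> * (k + 3) * (g \<bullet> e)"
    using arg_cong[OF v', of "\<lambda>w. g \<bullet> w"] by (simp add: inner_simps power2_norm_eq_inner)
  have cu: "(norm (anchor (k + 1) X' v'))\<^sup>2 = (norm u)\<^sup>2 - 8 * \<beta> * (g \<bullet> u) + 16 * \<beta>\<^sup>2 * (norm g)\<^sup>2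
      - 4 * \<beta> * (k + 3) * ((u - (4 * \<beta>) *\<^sub>R g) \<bullet> e) + 4 * \<beta>\<^sup>2 * (k + 3)\<^sup>2 * (norm e)\<^sup>2"
    unfolding anchor' power2_norm_eq_inner
    by (simp add: inner_simps inner_commute power2_eq_square algebra_simps)
  have ce: "c \<bullet> e = 16 * \<beta>\<^sup>2 / 3 * (k + 1) * (k + 3) * (g \<bullet> e)
      - 4 * \<beta> * (k + 3) * ((u - (4 * \<beta>) *\<^sub>R g) \<bullet> e)"
    by (simp add: c_def u_def inner_diff_left)
  have pot': "8 * \<beta> / 3 * ((k + 1) * (k + 1 + 4)) * (\<beta> * (norm g)\<^sup>2 - g \<bullet> v')
      = 8 * \<beta> / 3 * (k + 1) * (\<beta> * (k + 5) * (norm g)\<^sup>2 - (k + 5) * (g \<bullet> v'))"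
    by (simp add: field_simps)
  \<comment> \<open>The weights \<open>w k = (8 * \<beta> / 3) * k * (k + 4)\<close> solve \<open>k * w (k + 1) = (k + 5) * (w k - 8 * \<beta> * k)\<close>,
    which makes the coefficients of \<open>p\<close> and \<open>q\<close> opposite.\<close>
  have exact: "energy \<beta> (k + 1) X' v' g = energy \<beta> k X v h - 32 * \<beta> * (g \<bullet> X)
      - 8 * \<beta> / 3 * (k * (k + 4)) * (p - q) + \<beta>\<^sup>2 * (56 - 16 * k) / 3 * (norm g)\<^sup>2
      + 4 * \<beta>\<^sup>2 * (k + 3)\<^sup>2 * (norm e)\<^sup>2 + c \<bullet> e"
    unfolding energy_def cu pot' gv' gu ce u_def[symmetric] p_def q_def
    by (simp add: field_simps power2_eq_square)
  have gap: "p - q = (g - h) \<bullet> d - \<beta> * (norm (g - h))\<^sup>2"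
    unfolding p_def q_def v power2_norm_eq_inner
    by (simp add: inner_simps inner_commute algebra_simps)
  have L1: "\<beta> \<le> 1 / (4 * L)"
    using \<beta>L L by (simp add: field_simps)
  have A0: "0 \<le> A"
    using A by (smt (verit) zero_le_power2)
  have "(3 / (4 * L)) * A \<le> (1 / L) * A - \<beta> * A"
    using mult_right_mono[OF L1 A0] L by (simp add: field_simps)
  also have "\<dots> \<le> p - q"
    unfolding gap using coco mult_left_mono[OF A, of \<beta>] \<beta> by linarith
  finally have "8 * \<beta> / 3 * (k * (k + 4)) * ((3 / (4 * L)) * A) \<le> 8 * \<beta> / 3 * (k * (k + 4)) * (p - q)"
    using k \<beta> by (intro mult_left_mono) auto
  moreover have "8 * \<beta> / 3 * (k * (k + 4)) * ((3 / (4 * L)) * A) = 2 * \<beta> / L * (k * (k + 4)) * A"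
    using L by simp
  ultimately have pq: "2 * \<beta> / L * (k * (k + 4)) * A \<le> 8 * \<beta> / 3 * (k * (k + 4)) * (p - q)"
    by linarith
  have "4 * \<beta> * (norm g)\<^sup>2 \<le> (1 / L) * (norm g)\<^sup>2"
    using mult_right_mono[OF L1, of "(norm g)\<^sup>2"] by (simp add: field_simps)
  then have "4 * \<beta> * (norm g)\<^sup>2 \<le> g \<bullet> X"
    using mono by linarith
  then have gX: "128 * \<beta>\<^sup>2 * (norm g)\<^sup>2 \<le> 32 * \<beta> * (g \<bullet> X)"
    using \<beta> mult_left_mono[of "4 * \<beta> * (norm g)\<^sup>2" "g \<bullet> X" "32 * \<beta>"]
    by (simp add: power2_eq_square)
  have "\<beta>\<^sup>2 * (56 - 16 * k) / 3 * (norm g)\<^sup>2 - 128 * \<beta>\<^sup>2 * (norm g)\<^sup>2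
      = - (16 / 3 * \<beta>\<^sup>2 * (k + 1) * (norm g)\<^sup>2) - 104 * \<beta>\<^sup>2 * (norm g)\<^sup>2"
    by (simp add: field_simps)
  moreover have "0 \<le> 104 * \<beta>\<^sup>2 * (norm g)\<^sup>2"
    by simp
  ultimately show ?thesis
    using exact pq gX by linarith
qed

text \<open>
  The energy contains a negative term; expressing \<open>v\<close> through the anchor turns it into the
  monotonicity term at the previous iterate, up to a quadratic form that is positive definite.
\<close>
lemma energy_lower:
  fixes X v h Xp :: "'v :: real_inner"
  assumes k: "k \<ge> 0" and \<beta>: "\<beta> > 0" and L: "L > 0" and \<beta>L: "4 * \<beta> * L \<le> 1"
    and X: "X = Xp - (2 * \<beta>) *\<^sub>R h + v"
    and mono: "h \<bullet> Xp \<ge> (1 / L) * (norm h)\<^sup>2"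
  shows "(norm (anchor k X v))\<^sup>2 \<le> 3 * energy \<beta> k X v h"
    and "8 * (\<beta>\<^sup>2 * k\<^sup>2 * (norm h)\<^sup>2) \<le> 9 * energy \<beta> k X v h"
proof -
  define u where "u = anchor k X v"
  define w where "w = (k * \<beta>) *\<^sub>R h"
  have hX: "h \<bullet> X = h \<bullet> Xp - 2 * \<beta> * (norm h)\<^sup>2 + h \<bullet> v"
    unfolding X by (simp add: inner_simps power2_norm_eq_inner)
  have hu: "h \<bullet> u = 4 * (h \<bullet> X) + k * (h \<bullet> v)"
    by (simp add: u_def anchor_def inner_simps)
  have wu: "w \<bullet> u = k * \<beta> * (h \<bullet> u)" and ww: "(norm w)\<^sup>2 = k\<^sup>2 * \<beta>\<^sup>2 * (norm h)\<^sup>2"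
    by (simp_all add: w_def power_mult_distrib)
  have exact: "energy \<beta> k X v h = (norm u)\<^sup>2 - 8 / 3 * (w \<bullet> u) + 8 / 3 * (norm w)\<^sup>2
      + 32 * \<beta> / 3 * k * (h \<bullet> Xp - \<beta> * (norm h)\<^sup>2)"
    unfolding energy_def wu ww hu hX u_def[symmetric] by (simp add: field_simps power2_eq_square)
  have L1: "\<beta> \<le> 1 / L"
    using \<beta>L L \<beta> by (simp add: field_simps)
  then have "0 \<le> h \<bullet> Xp - \<beta> * (norm h)\<^sup>2"
    using mono mult_right_mono[OF L1, of "(norm h)\<^sup>2"] by (smt (verit) zero_le_power2)
  then have "0 \<le> 32 * \<beta> / 3 * k * (h \<bullet> Xp - \<beta> * (norm h)\<^sup>2)"
    using k \<beta> by (intro mult_nonneg_nonneg) auto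
  then have lower: "energy \<beta> k X v h \<ge> (norm u)\<^sup>2 - 8 / 3 * (w \<bullet> u) + 8 / 3 * (norm w)\<^sup>2"
    unfolding exact by linarith
  \<comment> \<open>The two squares split the quadratic form with nothing but a multiple of \<open>norm u ^ 2\<close>,
    respectively of \<open>norm w ^ 2\<close>, left over.\<close>
  have "(norm (u - 2 *\<^sub>R w))\<^sup>2 = (norm u)\<^sup>2 - 4 * (w \<bullet> u) + 4 * (norm w)\<^sup>2"
    by (simp add: power2_norm_eq_inner inner_simps inner_commute)
  then have 1: "(norm u)\<^sup>2 - 4 * (w \<bullet> u) + 4 * (norm w)\<^sup>2 \<ge> 0"
    by (metis zero_le_power2)
  have "(norm (3 *\<^sub>R u - 4 *\<^sub>R w))\<^sup>2 = 9 * (norm u)\<^sup>2 - 24 * (w \<bullet> u) + 16 * (norm w)\<^sup>2"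
    by (simp add: power2_norm_eq_inner inner_simps inner_commute)
  then have 2: "9 * (norm u)\<^sup>2 - 24 * (w \<bullet> u) + 16 * (norm w)\<^sup>2 \<ge> 0"
    by (metis zero_le_power2)
  show "(norm (anchor k X v))\<^sup>2 \<le> 3 * energy \<beta> k X v h"
    using lower 1 unfolding u_def[symmetric] by linarith
  have "8 * (norm w)\<^sup>2 \<le> 9 * energy \<beta> k X v h"
    using lower 2 by linarith
  then show "8 * (\<beta>\<^sup>2 * k\<^sup>2 * (norm h)\<^sup>2) \<le> 9 * energy \<beta> k X v h"
    unfolding ww by (simp add: mult_ac)
qed

text \<open>
  The relation \<open>(k + 4) * X = k * (Xp - 2 * \<beta> * g) + anchor k X v\<close> exhibits \<open>X\<close> as a convex
  combination of a step that is no farther from the zero than \<open>Xp\<close> and of a quarter of the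
  anchor.
\<close>
lemma distance_step:
  fixes X v g Xp :: "'v :: real_inner"
  assumes k: "k \<ge> 0" and \<beta>: "\<beta> > 0" and L: "L > 0" and \<beta>L: "4 * \<beta> * L \<le> 1"
    and X: "X = Xp - (2 * \<beta>) *\<^sub>R g + v"
    and mono: "g \<bullet> Xp \<ge> (1 / L) * (norm g)\<^sup>2"
  shows "(k + 4) * (norm X)\<^sup>2 \<le> k * (norm Xp)\<^sup>2 + (norm (anchor k X v))\<^sup>2 / 4"
proof -
  define T where "T = Xp - (2 * \<beta>) *\<^sub>R g"
  define u where "u = anchor k X v"
  have L1: "\<beta> \<le> 1 / L"
    using \<beta>L L \<beta> by (simp add: field_simps)
  have "\<beta> * (norm g)\<^sup>2 \<le> g \<bullet> Xp"
    using mono mult_right_mono[OF L1, of "(norm g)\<^sup>2"] by (smt (verit) zero_le_power2)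
  then have "4 * \<beta> * (\<beta> * (norm g)\<^sup>2) \<le> 4 * \<beta> * (g \<bullet> Xp)"
    using \<beta> by (intro mult_left_mono) auto
  moreover have "(norm T)\<^sup>2 = (norm Xp)\<^sup>2 - 4 * \<beta> * (g \<bullet> Xp) + 4 * \<beta> * (\<beta> * (norm g)\<^sup>2)"
    unfolding T_def power2_norm_eq_inner by (simp add: inner_simps inner_commute algebra_simps)
  ultimately have T: "(norm T)\<^sup>2 \<le> (norm Xp)\<^sup>2"
    by linarith
  have comb: "(k + 4) *\<^sub>R X = k *\<^sub>R T + u"
    unfolding T_def u_def anchor_def X by (simp add: algebra_simps)
  have "(k + 4)\<^sup>2 * (norm X)\<^sup>2 = (norm ((k + 4) *\<^sub>R X))\<^sup>2"
    by (simp add: power_mult_distrib)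
  also have "\<dots> = (k + 4) * (k * (norm T)\<^sup>2 + (norm u)\<^sup>2 / 4) - k * (norm (2 *\<^sub>R T - (1/2) *\<^sub>R u))\<^sup>2"
    unfolding comb power2_norm_eq_inner
    by (simp add: inner_simps inner_commute field_simps)
  also have "\<dots> \<le> (k + 4) * (k * (norm T)\<^sup>2 + (norm u)\<^sup>2 / 4)"
    using k by simp
  also have "\<dots> \<le> (k + 4) * (k * (norm Xp)\<^sup>2 + (norm u)\<^sup>2 / 4)"
    using k T by (intro mult_left_mono add_right_mono) auto
  finally have "(k + 4) * ((k + 4) * (norm X)\<^sup>2) \<le> (k + 4) * (k * (norm Xp)\<^sup>2 + (norm u)\<^sup>2 / 4)"
    by (simp add: power2_eq_square mult_ac)
  then show ?thesis
    using k unfolding u_def by simp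
qed

text \<open>
  The potential \<open>Z\<close> is a weighted squared velocity plus a multiple of the second summand of the
  energy. It involves no distance to a zero, so it can tend to zero where the energy need not. The
  last summand of \<open>Z\<close> carries a part of the decrease over to the next step, where it pays for the
  cross term of \<open>g\<close> and \<open>v\<close>.
\<close>
lemma velocity_step:
  fixes X v g h d e v' :: "'v :: real_inner"
  assumes k: "k \<ge> 0" and \<beta>: "\<beta> > 0"
    and v': "(k + 5) *\<^sub>R v' = k *\<^sub>R v + (4 * \<beta>) *\<^sub>R g - (2 * \<beta> * (k + 3)) *\<^sub>R e"
    and v: "v = d + (2 * \<beta>) *\<^sub>R h"
    and L: "L > 0" and \<beta>L: "4 * \<beta> * L \<le> 1"
    and coco: "(g - h) \<bullet> d \<ge> (1 / L) * (norm (g - h))\<^sup>2"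
  defines "Z \<equiv> \<lambda>k v h. k * (k + 4) * ((norm v)\<^sup>2 - \<beta> * (h \<bullet> v) + \<beta>\<^sup>2 * (norm h)\<^sup>2) + 3 / 2 * k * (norm v)\<^sup>2"
    and "c \<equiv> (2 * \<beta>\<^sup>2 * (k + 1) * (k + 3)) *\<^sub>R g - (4 * \<beta> * (k + 3)) *\<^sub>R (k *\<^sub>R v + (4 * \<beta>) *\<^sub>R g)"
  shows "Z (k + 1) v' g + (k + 1) * (norm v')\<^sup>2 \<le> Z k v h
     + 20 * \<beta>\<^sup>2 * (k + 1) * (norm g)\<^sup>2 + 4 * \<beta>\<^sup>2 * (k + 3)\<^sup>2 * (norm e)\<^sup>2 + c \<bullet> e"
proof -
  have gv': "(k + 5) * (g \<bullet> v') = k * (g \<bullet> v) + 4 * \<beta> * (norm g)\<^sup>2 - 2 * \<beta> * (k + 3) * (g \<bullet> e)"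
    using arg_cong[OF v', of "\<lambda>w. g \<bullet> w"] by (simp add: inner_simps power2_norm_eq_inner)
  define V where "V = (norm v')\<^sup>2"
  have "(k + 5)\<^sup>2 * V = (norm ((k + 5) *\<^sub>R v'))\<^sup>2"
    by (simp add: power_mult_distrib V_def)
  also have "\<dots> = k\<^sup>2 * (norm v)\<^sup>2 + 8 * \<beta> * k * (g \<bullet> v) + 16 * \<beta>\<^sup>2 * (norm g)\<^sup>2
     - 4 * \<beta> * (k + 3) * ((k *\<^sub>R v + (4 * \<beta>) *\<^sub>R g) \<bullet> e) + 4 * \<beta>\<^sup>2 * (k + 3)\<^sup>2 * (norm e)\<^sup>2"
    unfolding v' power2_norm_eq_inner
    by (simp add: inner_simps inner_commute power2_eq_square algebra_simps)
  finally have vv: "(k + 5)\<^sup>2 * V = \<dots>" .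
  have gap: "(g \<bullet> v - \<beta> * (norm g)\<^sup>2) - (h \<bullet> v - \<beta> * (norm h)\<^sup>2) = (g - h) \<bullet> d - \<beta> * (norm (g - h))\<^sup>2"
    unfolding v power2_norm_eq_inner by (simp add: inner_simps inner_commute algebra_simps)
  have L1: "\<beta> \<le> 1 / L"
    using \<beta>L L \<beta> by (simp add: field_simps)
  have "0 \<le> (g \<bullet> v - \<beta> * (norm g)\<^sup>2) - (h \<bullet> v - \<beta> * (norm h)\<^sup>2)"
    unfolding gap using coco mult_right_mono[OF L1, of "(norm (g - h))\<^sup>2"] by (smt (verit) zero_le_power2)
  then have pq: "0 \<le> \<beta> * (k * (k + 4)) * ((g \<bullet> v - \<beta> * (norm g)\<^sup>2) - (h \<bullet> v - \<beta> * (norm h)\<^sup>2))"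
    using k \<beta> by (intro mult_nonneg_nonneg) auto
  have "2 * \<beta> * (g \<bullet> v) \<le> (norm v)\<^sup>2 + \<beta>\<^sup>2 * (norm g)\<^sup>2"
  proof -
    have "(norm (v - \<beta> *\<^sub>R g))\<^sup>2 = (norm v)\<^sup>2 + \<beta>\<^sup>2 * (norm g)\<^sup>2 - 2 * \<beta> * (g \<bullet> v)"
      unfolding power2_norm_eq_inner
      by (simp add: inner_simps inner_commute power2_eq_square algebra_simps)
    then show ?thesis by (smt (verit) zero_le_power2)
  qed
  then have young: "11 / 2 * k * (2 * \<beta> * (g \<bullet> v)) \<le> 11 / 2 * k * ((norm v)\<^sup>2 + \<beta>\<^sup>2 * (norm g)\<^sup>2)"
    using k by (intro mult_left_mono) auto
  have ce: "c \<bullet> e = 2 * \<beta>\<^sup>2 * (k + 1) * (k + 3) * (g \<bullet> e)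
      - 4 * \<beta> * (k + 3) * ((k *\<^sub>R v + (4 * \<beta>) *\<^sub>R g) \<bullet> e)"
    by (simp add: c_def inner_diff_left)
  have "Z (k + 1) v' g + (k + 1) * V = (k + 5)\<^sup>2 * V - 3 / 2 * (k + 1) * V - 16 * V
      - \<beta> * (k + 1) * ((k + 5) * (g \<bullet> v')) + \<beta>\<^sup>2 * (k + 1) * (k + 5) * (norm g)\<^sup>2"
    unfolding Z_def V_def by (simp add: field_simps power2_eq_square)
  also have "\<dots> = Z k v h - \<beta> * (k * (k + 4)) * ((g \<bullet> v - \<beta> * (norm g)\<^sup>2) - (h \<bullet> v - \<beta> * (norm h)\<^sup>2))
      + 11 / 2 * k * (2 * \<beta> * (g \<bullet> v)) - 11 / 2 * k * (norm v)\<^sup>2 - \<beta>\<^sup>2 * (2 * k - 17) * (norm g)\<^sup>2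
      - 3 / 2 * (k + 1) * V - 16 * V + 4 * \<beta>\<^sup>2 * (k + 3)\<^sup>2 * (norm e)\<^sup>2 + c \<bullet> e"
    unfolding Z_def vv gv' ce by (simp add: field_simps power2_eq_square)
  also have "\<dots> \<le> Z k v h + \<beta>\<^sup>2 * (7 / 2 * k + 17) * (norm g)\<^sup>2
      + 4 * \<beta>\<^sup>2 * (k + 3)\<^sup>2 * (norm e)\<^sup>2 + c \<bullet> e"
  proof -
    have "0 \<le> 3 / 2 * (k + 1) * V + 16 * V"
      using k by (simp add: V_def)
    moreover have "\<beta>\<^sup>2 * (7 / 2 * k + 17) * (norm g)\<^sup>2
        = 11 / 2 * k * ((norm v)\<^sup>2 + \<beta>\<^sup>2 * (norm g)\<^sup>2) - 11 / 2 * k * (norm v)\<^sup>2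
          - \<beta>\<^sup>2 * (2 * k - 17) * (norm g)\<^sup>2"
      by (simp add: field_simps)
    ultimately show ?thesis
      using pq young by linarith
  qed
  also have "\<beta>\<^sup>2 * (7 / 2 * k + 17) * (norm g)\<^sup>2 \<le> \<beta>\<^sup>2 * (20 * (k + 1)) * (norm g)\<^sup>2"
    using k by (intro mult_right_mono mult_left_mono) auto
  finally show ?thesis
    by (simp add: V_def algebra_simps)
qed

section \<open>Quasi-decreasing sequences\<close>

lemma summable_of_decrease:
  fixes a Y :: "nat \<Rightarrow> real"
  assumes a: "\<And>k. 0 \<le> a k" and Y: "\<And>k. 0 \<le> Y k"
    and s: "\<And>k. 0 \<le> s k" "summable s"
    and step: "\<And>k. Y (Suc k) + a k \<le> Y k + s k"
  shows "summable a"
proof (rule summableI_nonneg_bounded[OF a])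
  fix m
  have "(\<Sum>k<m. a k) + Y m \<le> Y 0 + (\<Sum>k<m. s k)"
  proof (induction m)
    case (Suc m)
    then show ?case using step[of m] by simp
  qed simp
  moreover have "(\<Sum>k<m. s k) \<le> suminf s"
    using s by (intro sum_le_suminf) auto
  ultimately show "(\<Sum>k<m. a k) \<le> Y 0 + suminf s"
    using Y[of m] by linarith
qed

text \<open>
  Up to a summable error the sequence decreases, hence it converges; a positive limit would make
  the weighted series diverge like the harmonic one.
\<close>
lemma tendsto_zero_of_quasi_decreasing:
  fixes Y s :: "nat \<Rightarrow> real"
  assumes Y: "\<And>k. 0 \<le> Y k" and s: "\<And>k. 0 \<le> s k" "summable s"
    and step: "\<And>k. Y (Suc k) \<le> Y k + s k"
    and weighted: "summable (\<lambda>k. Y k / (real k + 4))"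
  shows "Y \<longlonglongrightarrow> 0"
proof -
  define W where "W k = Y k - (\<Sum>j<k. s j)" for k
  have dec: "decseq W"
    using step by (intro decseq_SucI) (simp add: W_def algebra_simps)
  have "- suminf s \<le> W k" for k
    using Y[of k] sum_le_suminf[OF s(2), of "{..<k}"] s by (simp add: W_def)
  then obtain l where l: "W \<longlonglongrightarrow> l"
    using decseq_convergent[OF dec] by metis
  have "(\<lambda>k. W k + (\<Sum>j<k. s j)) \<longlonglongrightarrow> l + suminf s"
    by (intro tendsto_add l summable_LIMSEQ s)
  then have lim: "Y \<longlonglongrightarrow> l + suminf s"
    by (simp add: W_def)
  moreover have "l + suminf s = 0"
  proof (rule ccontr)
    assume "l + suminf s \<noteq> 0"
    moreover have "0 \<le> l + suminf s"
      by (rule LIMSEQ_le_const[OF lim]) (use Y in auto)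
    moreover define c where "c = (l + suminf s) / 2"
    ultimately have pos: "0 < c" and "c < l + suminf s"
      by auto
    then have "eventually (\<lambda>k. c < Y k) sequentially"
      using lim by (intro order_tendstoD)
    then have "eventually (\<lambda>k. norm (c * inverse (real (k + 4))) \<le> Y k / (real k + 4)) sequentially"
    proof eventually_elim
      case (elim k)
      then have "c / (real k + 4) \<le> Y k / (real k + 4)"
        by (intro divide_right_mono) auto
      moreover have "norm (c * inverse (real (k + 4))) = c / (real k + 4)"
        using pos by (simp add: divide_inverse abs_mult)
      ultimately show ?case by linarith
    qed
    then have "summable (\<lambda>k. c * inverse (real (k + 4)))"
      using weighted by (rule summable_comparison_test_ev)
    then have "summable (\<lambda>k. inverse (real (k + 4)))"
      using pos by (subst (asm) summable_cmult_iff) auto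
    then have "summable (\<lambda>k. inverse (real k))"
      by (subst (asm) summable_iff_shift)
    then show False
      using not_summable_harmonic[where 'a = real] by simp
  qed
  ultimately show ?thesis by simp
qed

section \<open>The step size and the constants\<close>

text \<open>
  This form of the bound on the batch size says that the two summands in the denominator of
  \<open>beta\<close> are ordered, which gives \<open>4 * L * beta \<le> 1\<close>.
\<close>
lemma batch_cube_le:
  assumes n: "n \<ge> 1" and b: "real b \<le> min (real n) (4 * real n powr (2 / 3))"
  shows "real b ^ 3 \<le> 64 * (real n)\<^sup>2"
proof -
  have "real b ^ 3 \<le> (4 * real n powr (2 / 3)) ^ 3"
    using b by (intro power_mono) auto
  also have "\<dots> = 64 * (real n powr (2 / 3)) ^ 3"
    by (simp add: power_mult_distrib)
  also have "(real n powr (2 / 3)) ^ 3 = (real n)\<^sup>2"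
    using n by (subst powr_power) (auto simp: powr_numeral)
  finally show ?thesis .
qed

lemma step_size:
  assumes n: "n \<ge> 1" and L: "L > 0" and b: "b \<ge> 1" "real b \<le> min (real n) (4 * real n powr (2 / 3))"
  shows beta_pos: "beta n b L > 0"
    and beta_bounds: "beta n b L \<in> {1 / (2 * L * (1 + 64 * (real n)\<^sup>2)) .. 1 / (4 * L)}"
    and beta_div_b: "beta n b L / real b \<le> 1 / (128 * L)"
    and beta_div_b3: "beta n b L * (real n)\<^sup>2 / real b ^ 3 \<le> 1 / (128 * L)"
    and psi_eq: "psi n b = 1 - 2 * (L * beta n b L)"
proof -
  let ?B = "real b ^ 3" and ?N = "64 * (real n)\<^sup>2"
  have B: "?B \<ge> 1" and N: "?N > 0"
    using b n by (simp_all add: one_le_power)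
  have BN: "?B \<le> ?N"
    by (rule batch_cube_le[OF n b(2)])
  have sum: "?B + ?N > 0"
    using B N by linarith
  show "beta n b L > 0"
    unfolding beta_def by (intro divide_pos_pos mult_pos_pos) (use B sum L in linarith)+
  have "1 / (2 * L * (1 + ?N)) \<le> beta n b L"
  proof -
    have "?B + ?N \<le> ?B * (1 + ?N)"
      using mult_right_mono[OF B, of ?N] N by (simp add: algebra_simps)
    then have "1 \<le> ?B / (?B + ?N) * (1 + ?N)"
      using sum by (simp only: times_divide_eq_left le_divide_eq_1_pos)
    then have "1 / (1 + ?N) \<le> ?B / (?B + ?N)"
      by (simp only: pos_divide_le_eq[OF add_pos_pos[OF zero_less_one N]])
    then have "1 / (2 * L) * (1 / (1 + ?N)) \<le> 1 / (2 * L) * (?B / (?B + ?N))"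
      using L by (intro mult_left_mono) auto
    then show ?thesis
      by (simp add: beta_def)
  qed
  moreover have "beta n b L \<le> 1 / (4 * L)"
    using L sum BN by (simp add: beta_def divide_simps)
  ultimately show "beta n b L \<in> {1 / (2 * L * (1 + 64 * (real n)\<^sup>2)) .. 1 / (4 * L)}"
    by simp
  have le: "beta n b L \<le> ?B / (2 * L * ?N)"
    unfolding beta_def using L B N b n by (intro divide_left_mono mult_left_mono mult_pos_pos add_pos_pos) auto
  have "beta n b L / real b \<le> ?B / (2 * L * ?N) / real b"
    using le by (intro divide_right_mono) auto
  also have "\<dots> = (real b)\<^sup>2 / (real n)\<^sup>2 * (1 / (128 * L))"
    using b by (simp add: power2_eq_square power3_eq_cube)
  also have "\<dots> \<le> 1 * (1 / (128 * L))"
    using b n L by (intro mult_right_mono) (auto intro!: power_mono)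
  finally show "beta n b L / real b \<le> 1 / (128 * L)"
    by simp
  have "beta n b L * ((real n)\<^sup>2 / ?B) \<le> ?B / (2 * L * ?N) * ((real n)\<^sup>2 / ?B)"
    using le by (intro mult_right_mono) auto
  also have "\<dots> = 1 / (128 * L)"
    using b n by simp
  finally show "beta n b L * (real n)\<^sup>2 / real b ^ 3 \<le> 1 / (128 * L)"
    by simp
  show "psi n b = 1 - 2 * (L * beta n b L)"
    using L sum by (simp add: psi_def beta_def divide_simps)
qed

text \<open>
  With \<open>psi = 1 - 2 * L * beta\<close> the constants are polynomials in \<open>L * beta\<close>, which lies between
  0 and \<open>1 / 4\<close>. The lower bounds exceed the constants 504 and 180 that the energy argument
  yields for the displacement and for the operator value.
\<close>
lemma constant_bounds:
  assumes t: "0 \<le> L * beta n b L" "L * beta n b L \<le> 1 / 4" and psi: "psi n b = 1 - 2 * (L * beta n b L)"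
  shows "C2 n b L \<le> 2559" "C3 n b L \<le> 3636" "1681 \<le> C2 n b L" "2383 \<le> C3 n b L"
proof -
  define t where "t = L * beta n b L"
  have t0: "0 \<le> t" "t \<le> 1 / 4" using t by (simp_all add: t_def)
  have sq: "L\<^sup>2 * (beta n b L)\<^sup>2 = t\<^sup>2" by (simp add: t_def power_mult_distrib)
  have t2: "0 \<le> t\<^sup>2" "t\<^sup>2 \<le> 1 / 16"
    using power_mono[OF t0(2,1), of 2] by (simp_all add: power_divide)
  have psi': "1 / 2 \<le> psi n b" "psi n b \<le> 1"
    using t0 psi by (simp_all add: t_def)
  have C0: "30 \<le> C0 n b L" "C0 n b L \<le> 69 / 2"
    using t2 unfolding C0_def by (simp_all add: mult.assoc sq)
  have prod: "psi n b * C0 n b L \<le> 69 / 2" "15 \<le> psi n b * C0 n b L"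
    using mult_mono[OF psi'(2) C0(2)] mult_mono[OF psi'(1) C0(1)] C0 psi' by simp_all
  have C1_eq: "C1 n b L = 72 * t\<^sup>2 / 5 + (2 / 3 * C0 n b L + psi n b * C0 n b L)"
    unfolding C1_def by (simp add: mult.assoc sq distrib_right)
  have C1: "35 \<le> C1 n b L" "C1 n b L \<le> 584 / 10"
    using t2 C0 prod unfolding C1_eq by linarith+
  have C2_eq: "C2 n b L = 36 * t\<^sup>2 + (50 / 3 * C0 n b L + psi n b * C0 n b L) + 100 * C1 n b L / 3"
    unfolding C2_def by (simp add: mult.assoc sq distrib_right)
  show C2: "C2 n b L \<le> 2559" "1681 \<le> C2 n b L"
    using t2 C0 C1 prod unfolding C2_eq by linarith+
  have "C1 n b L + C2 n b L \<le> 584 / 10 + (36 / 16 + 50 / 3 * (69 / 2) + 69 / 2 + 100 * (584 / 10) / 3)"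
    using t2 C0 C1 prod unfolding C2_eq by linarith
  then show "C3 n b L \<le> 3636" "2383 \<le> C3 n b L"
    using C1 C2 unfolding C3_def by simp_all
qed

section \<open>The iteration and its sampling error\<close>

lemma avg_map_eq: "avg_map n G z = avg n (\<lambda>i. G i z)"
  by (simp add: avg_map_def avg_def)

context vfkm_saga
begin

abbreviation \<beta> :: real where "\<beta> \<equiv> beta n b L"

definition g :: "nat \<Rightarrow> 'w \<Rightarrow> real^'p" where
  "g k \<omega> = avg_map n G (x k \<omega>)"

definition v :: "nat \<Rightarrow> 'w \<Rightarrow> real^'p" where
  "v k \<omega> = (x k \<omega> - x (k - 1) \<omega>) + (2 * \<beta>) *\<^sub>R g (k - 1) \<omega>"

definition table :: "nat \<Rightarrow> 'w \<Rightarrow> nat \<Rightarrow> real^'p" where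
  "table k \<omega> = saga_table G (\<lambda>k. H k \<omega>) (\<lambda>k. x k \<omega>) k"

definition est :: "nat \<Rightarrow> 'w \<Rightarrow> real^'p" where
  "est k \<omega> = saga_estimator n b G (\<lambda>k. I k \<omega>) (\<lambda>k. H k \<omega>) (\<lambda>k. x k \<omega>) k"

definition err :: "nat \<Rightarrow> 'w \<Rightarrow> real^'p" where
  "err k \<omega> = est k \<omega> - (g k \<omega> - gam k *\<^sub>R g (k - 1) \<omega>)"

text \<open>
  The two quantities that drive the variance of the estimator: how far the component maps moved in
  the last step, and how far the table lags behind the previous iterate.
\<close>
definition move :: "nat \<Rightarrow> 'w \<Rightarrow> real" where
  "move k \<omega> = avg n (\<lambda>i. (norm (G i (x k \<omega>) - G i (x (k - 1) \<omega>)))\<^sup>2)"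

definition stale :: "nat \<Rightarrow> 'w \<Rightarrow> real" where
  "stale k \<omega> = avg n (\<lambda>i. (norm (G i (x (k - 1) \<omega>) - table k \<omega> i))\<^sup>2)"

lemma step_pos: "\<beta> > 0" and four_step_L_le: "4 * \<beta> * L \<le> 1"
proof -
  show "\<beta> > 0"
    using beta_pos n_pos L_pos batch_size by blast
  have "\<beta> \<le> 1 / (4 * L)"
    using beta_bounds[OF n_pos L_pos batch_size] by simp
  then show "4 * \<beta> * L \<le> 1"
    using L_pos by (simp add: field_simps)
qed

lemma b_le_n: "b \<le> n"
  using batch_size by simp

lemma x_0: "\<omega> \<in> space M \<Longrightarrow> x 0 \<omega> = x0"
  and x_Suc: "\<omega> \<in> space M \<Longrightarrow>
    x (Suc k) \<omega> = x k \<omega> + theta k *\<^sub>R (x k \<omega> - x (k - 1) \<omega>) - eta \<beta> k *\<^sub>R est k \<omega>"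
  using run[of \<omega>] unfolding vfkm_saga_run_def est_def by blast+

lemma table_0: "table 0 \<omega> i = G i (x 0 \<omega>)"
  and table_Suc: "table (Suc k) \<omega> i = (if i \<in> H (Suc k) \<omega> then G i (x k \<omega>) else table k \<omega> i)"
  by (simp_all add: table_def)

lemma err_0: "err 0 \<omega> = 0"
  by (simp add: err_def est_def saga_estimator_def g_def)

definition resid :: "nat \<Rightarrow> 'w \<Rightarrow> nat set \<Rightarrow> nat \<Rightarrow> real^'p" where
  "resid m \<omega> A i = (G i (x (Suc m) \<omega>) - gam (Suc m) *\<^sub>R G i (x m \<omega>))
     - (1 - gam (Suc m)) *\<^sub>R (if i \<in> A then G i (x m \<omega>) else table m \<omega> i)"

text \<open>
  The estimator is \<open>1 - gam (Suc m)\<close> times the mean of the table plus the batch mean of the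
  residuals; its target is the same expression with the full mean of the residuals.
\<close>
lemma err_Suc:
  "err (Suc m) \<omega> = batch_avg b (I (Suc m) \<omega>) (resid m \<omega> (H (Suc m) \<omega>))
     - avg n (resid m \<omega> (H (Suc m) \<omega>))"
proof -
  have resid: "resid m \<omega> (H (Suc m) \<omega>) = (\<lambda>i. (G i (x (Suc m) \<omega>) - gam (Suc m) *\<^sub>R G i (x m \<omega>))
     - (1 - gam (Suc m)) *\<^sub>R table (Suc m) \<omega> i)"
    by (simp add: fun_eq_iff resid_def table_Suc)
  show ?thesis
    unfolding resid batch_avg_diff batch_avg_scaleR avg_diff avg_scaleR
    by (simp add: err_def est_def saga_estimator_def g_def avg_map_eq table_def[symmetric] avg_def
        del: saga_table.simps)
qed

lemma velocity_recursion:
  assumes "\<omega> \<in> space M"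
  shows "(real k + 5) *\<^sub>R v (Suc k) \<omega>
       = real k *\<^sub>R v k \<omega> + (4 * \<beta>) *\<^sub>R g k \<omega> - (2 * \<beta> * (real k + 3)) *\<^sub>R err k \<omega>"
proof -
  have th: "(real k + 5) * theta k = real k" and et: "(real k + 5) * eta \<beta> k = 2 * \<beta> * (real k + 3)"
    and ga: "(real k + 3) * gam k = real k"
    by (simp_all add: theta_def eta_def gam_def)
  have "(real k + 5) *\<^sub>R v (Suc k) \<omega>
      = ((real k + 5) * theta k) *\<^sub>R (x k \<omega> - x (k - 1) \<omega>)
        - ((real k + 5) * eta \<beta> k) *\<^sub>R est k \<omega> + (2 * \<beta> * (real k + 5)) *\<^sub>R g k \<omega>"
    unfolding v_def x_Suc[OF assms] diff_Suc_1
    by (simp add: algebra_simps)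
  also have "est k \<omega> = err k \<omega> + g k \<omega> - gam k *\<^sub>R g (k - 1) \<omega>"
    by (simp add: err_def)
  also have "((real k + 5) * theta k) *\<^sub>R (x k \<omega> - x (k - 1) \<omega>)
      - ((real k + 5) * eta \<beta> k) *\<^sub>R (err k \<omega> + g k \<omega> - gam k *\<^sub>R g (k - 1) \<omega>)
      + (2 * \<beta> * (real k + 5)) *\<^sub>R g k \<omega>
      = real k *\<^sub>R (x k \<omega> - x (k - 1) \<omega>) - (2 * \<beta> * (real k + 3)) *\<^sub>R err k \<omega> + (4 * \<beta>) *\<^sub>R g k \<omega>
        + (2 * \<beta> * ((real k + 3) * gam k)) *\<^sub>R g (k - 1) \<omega>"
    unfolding th et by (simp add: algebra_simps flip: scaleR_add_left)
  finally show ?thesis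
    unfolding ga by (simp add: v_def algebra_simps)
qed

lemma x_Suc_velocity: "x (Suc k) \<omega> = x k \<omega> - (2 * \<beta>) *\<^sub>R g k \<omega> + v (Suc k) \<omega>"
  by (simp add: v_def)

lemma cocoercive_avg:
  "(avg_map n G y - avg_map n G z) \<bullet> (y - z) \<ge> (1 / L) * avg n (\<lambda>i. (norm (G i y - G i z))\<^sup>2)"
  and avg_norm2_ge: "avg n (\<lambda>i. (norm (G i y - G i z))\<^sup>2) \<ge> (norm (avg_map n G y - avg_map n G z))\<^sup>2"
proof -
  have "(avg_map n G y - avg_map n G z) \<bullet> (y - z) = avg n (\<lambda>i. (G i y - G i z) \<bullet> (y - z))"
    by (simp add: avg_map_eq avg_inner inner_commute flip: avg_diff)
  then show "(avg_map n G y - avg_map n G z) \<bullet> (y - z) \<ge> (1 / L) * avg n (\<lambda>i. (norm (G i y - G i z))\<^sup>2)"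
    using cocoercive unfolding average_cocoercive_def avg_def by simp
  show "avg n (\<lambda>i. (norm (G i y - G i z))\<^sup>2) \<ge> (norm (avg_map n G y - avg_map n G z))\<^sup>2"
    using norm2_avg_le[OF n_pos, of "\<lambda>i. G i y - G i z"] by (simp add: avg_map_eq avg_diff)
qed

lemma monotone_at_zero:
  assumes "xs \<in> zer (avg_map n G)"
  shows "g k \<omega> \<bullet> (x k \<omega> - xs) \<ge> (1 / L) * (norm (g k \<omega>))\<^sup>2"
proof -
  have "(1 / L) * (norm (g k \<omega>))\<^sup>2 \<le> (1 / L) * avg n (\<lambda>i. (norm (G i (x k \<omega>) - G i xs))\<^sup>2)"
    using avg_norm2_ge[where y = "x k \<omega>" and z = xs] assms L_pos
    by (intro mult_left_mono) (auto simp: g_def zer_def)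
  then show ?thesis
    using cocoercive_avg[where y = "x k \<omega>" and z = xs] assms by (simp add: g_def zer_def)
qed

lemma move_coco: "(g k \<omega> - g (k - 1) \<omega>) \<bullet> (x k \<omega> - x (k - 1) \<omega>) \<ge> (1 / L) * move k \<omega>"
  and move_ge: "move k \<omega> \<ge> (norm (g k \<omega> - g (k - 1) \<omega>))\<^sup>2"
  unfolding g_def move_def by (rule cocoercive_avg avg_norm2_ge)+

lemma move_nonneg: "0 \<le> move k \<omega>" and stale_nonneg: "0 \<le> stale k \<omega>"
  unfolding move_def stale_def by (auto intro!: avg_nonneg)

lemma iterates_agree:
  assumes \<omega>: "\<omega> \<in> space M" "\<omega>' \<in> space M" and agree: "\<forall>j\<in>{1..m}. sample j \<omega> = sample j \<omega>'"
  shows "j \<le> m \<Longrightarrow> table j \<omega> = table j \<omega>' \<and> x j \<omega> = x j \<omega>' \<and> x (Suc j) \<omega> = x (Suc j) \<omega>'"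
proof (induction j)
  case 0
  have "x 0 \<omega> = x 0 \<omega>'"
    using \<omega> by (simp add: x_0)
  moreover from this have "est 0 \<omega> = est 0 \<omega>'"
    by (simp add: est_def saga_estimator_def)
  ultimately show ?case
    using \<omega> by (simp add: x_Suc table_0 fun_eq_iff)
next
  case (Suc j)
  then have IH: "table j \<omega> = table j \<omega>'" "x j \<omega> = x j \<omega>'" "x (Suc j) \<omega> = x (Suc j) \<omega>'"
    and now: "I (Suc j) \<omega> = I (Suc j) \<omega>'" "H (Suc j) \<omega> = H (Suc j) \<omega>'"
    using agree by auto
  have tab: "table (Suc j) \<omega> = table (Suc j) \<omega>'"
    by (simp add: fun_eq_iff table_Suc IH now)
  then have "est (Suc j) \<omega> = est (Suc j) \<omega>'"
    unfolding est_def saga_estimator_def table_def[symmetric] by (simp add: IH now)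
  then show ?case
    using \<omega> by (simp add: x_Suc[of _ "Suc j"] tab IH)
qed

text \<open>
  Sample \<open>m\<close> is used to compute \<open>x (Suc m)\<close>, so the iterates are one index ahead of the table.
\<close>
lemma determinedI:
  assumes "\<And>\<omega> \<omega>'. (\<And>j. j \<le> Suc m \<Longrightarrow> x j \<omega> = x j \<omega>') \<Longrightarrow> (\<And>j. j \<le> m \<Longrightarrow> table j \<omega> = table j \<omega>') \<Longrightarrow>
    (\<And>j. 1 \<le> j \<Longrightarrow> j \<le> m \<Longrightarrow> I j \<omega> = I j \<omega>') \<Longrightarrow> (\<And>j. 1 \<le> j \<Longrightarrow> j \<le> m \<Longrightarrow> H j \<omega> = H j \<omega>') \<Longrightarrow>
    Y \<omega> = Y \<omega>'"
  shows "determined m Y"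
  unfolding determined_def
proof (intro ballI impI)
  fix \<omega> \<omega>' assume \<omega>: "\<omega> \<in> space M" "\<omega>' \<in> space M" "\<forall>j\<in>{1..m}. sample j \<omega> = sample j \<omega>'"
  show "Y \<omega> = Y \<omega>'"
  proof (rule assms)
    fix j assume "j \<le> Suc m"
    then show "x j \<omega> = x j \<omega>'"
      using iterates_agree[OF \<omega>, of j] iterates_agree[OF \<omega>, of m] by (cases "j = Suc m") auto
  qed (use iterates_agree[OF \<omega>] \<omega>(3) in auto)
qed

lemma err_determined: "determined k (err k)"
proof (cases k)
  case 0
  then show ?thesis by (auto intro!: determinedI simp: err_0)
next
  case (Suc m)
  show ?thesis
    unfolding Suc by (rule determinedI) (simp add: err_Suc resid_def[abs_def] cong: if_cong)
qed

lemma integrable_iterates [simp, intro]: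
  "integrable M (move k)" "integrable M (stale k)"
  "integrable M (\<lambda>\<omega>. (norm (g k \<omega>))\<^sup>2)" "integrable M (\<lambda>\<omega>. (norm (v k \<omega>))\<^sup>2)"
  "integrable M (\<lambda>\<omega>. (norm (x k \<omega> - xs))\<^sup>2)"
  "integrable M (\<lambda>\<omega>. (norm (x (Suc k) \<omega> - x k \<omega>))\<^sup>2)"
  "integrable M (\<lambda>\<omega>. (norm (anchor (real k) (x k \<omega> - xs) (v k \<omega>)))\<^sup>2)"
  "integrable M (\<lambda>\<omega>. energy \<beta> (real k) (x k \<omega> - xs) (v k \<omega>) (g (k - 1) \<omega>))"
  by (rule integrable_determined[of k], rule determinedI,
      simp add: move_def stale_def g_def v_def)+

lemma integrable_err [simp, intro]: "integrable M (\<lambda>\<omega>. (norm (err k \<omega>))\<^sup>2)"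
  by (rule integrable_determined[of k]) (rule determined_comp[OF err_determined])

lemma integrable_inner_err:
  "determined k c \<Longrightarrow> integrable M (\<lambda>\<omega>. c \<omega> \<bullet> err k \<omega>)"
  by (rule integrable_determined[of k]) (rule determined_comp2[OF _ err_determined])

lemma finite_supports:
  "finite (set_pmf (uniform_batch n b))" "finite (set_pmf (uniform_subset n b))"
proof -
  show "finite (set_pmf (uniform_batch n b))"
    using n_pos by (intro finite_set_replicate_pmf) simp
  have "finite {A. A \<subseteq> {1..n} \<and> card A = b}"
    by (rule finite_subset[of _ "Pow {1..n}"]) auto
  moreover have "{A. A \<subseteq> {1..n} \<and> card A = b} \<noteq> {}"
    using b_le_n by (auto intro!: exI[of _ "{1..b}"])
  ultimately show "finite (set_pmf (uniform_subset n b))"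
    by simp
qed

lemma resid_determined: "determined m (resid m)"
  by (rule determinedI) (simp add: resid_def[abs_def] cong: if_cong)

text \<open>
  The batch is independent of the refreshed set, so the error has mean zero even after the table
  has been updated with the set drawn in the same iteration.
\<close>
lemma err_unbiased:
  assumes c: "determined (k - 1) c"
  shows "expectation (\<lambda>\<omega>. c \<omega> \<bullet> err k \<omega>) = 0"
proof (cases k)
  case 0
  then show ?thesis by (simp add: err_0)
next
  case (Suc m)
  define f where "f = (\<lambda>\<omega> (J, A). c \<omega> \<bullet> (batch_avg b J (resid m \<omega> A) - avg n (resid m \<omega> A)))"
  have det: "determined m f"
    unfolding f_def using c resid_determined unfolding Suc
    by (intro determined_comp2[where f = "\<lambda>c r (J, A). c \<bullet> (batch_avg b J (r A) - avg n (r A))"]) auto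
  have batch: "measure_pmf.expectation (uniform_batch n b) (\<lambda>J. c \<omega> \<bullet> (batch_avg b J r - avg n r)) = 0" for \<omega> r
  proof -
    have "measure_pmf.expectation (uniform_batch n b) (\<lambda>J. c \<omega> \<bullet> batch_avg b J r - c \<omega> \<bullet> avg n r)
        = measure_pmf.expectation (uniform_batch n b) (\<lambda>J. c \<omega> \<bullet> batch_avg b J r)
          - measure_pmf.expectation (uniform_batch n b) (\<lambda>J. c \<omega> \<bullet> avg n r)"
      by (intro Bochner_Integration.integral_diff integrable_measure_pmf_finite finite_supports)
    then show ?thesis
      unfolding inner_diff_right batch_avg_unbiased[OF n_pos batch_size(1)] by simp
  qed
  have avg0: "measure_pmf.expectation sample_law (f \<omega>) = 0" for \<omega>
    unfolding f_def expectation_pair_finite[OF finite_supports] split_conv batch by simp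
  have "(\<lambda>\<omega>. c \<omega> \<bullet> err k \<omega>) = (\<lambda>\<omega>. f \<omega> (sample (Suc m) \<omega>))"
    by (simp add: Suc f_def err_Suc)
  then show ?thesis
    by (simp only: expectation_fresh_sample[OF det] avg0) simp
qed

text \<open>
  A residual is the move of a component map plus \<open>1 - gam k = 3 / (k + 3)\<close> times the lag of its
  table entry, so the staleness enters without the growing weight \<open>(k + 3) ^ 2\<close> of the noise.
\<close>
lemma err_variance:
  "expectation (\<lambda>\<omega>. (norm (err k \<omega>))\<^sup>2)
     \<le> (1 / real b) * (2 * expectation (move k) + 18 / (real k + 3)\<^sup>2 * expectation (stale k))"
proof (cases k)
  case 0
  have "0 \<le> expectation (move k)" "0 \<le> expectation (stale k)"
    by (auto intro: integral_nonneg_AE move_nonneg stale_nonneg)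
  then show ?thesis
    using 0 by (auto simp: err_0 intro!: divide_nonneg_nonneg add_nonneg_nonneg)
next
  case (Suc m)
  define f where "f = (\<lambda>\<omega> (J, A). (norm (batch_avg b J (resid m \<omega> A) - avg n (resid m \<omega> A)))\<^sup>2)"
  define h where "h = (\<lambda>\<omega> (J :: nat list, A). (1 / real b) * avg n (\<lambda>i. (norm (resid m \<omega> A i))\<^sup>2))"
  have f: "determined m f" and h: "determined m h"
    unfolding f_def h_def
    using determined_comp[OF resid_determined, where f = "\<lambda>r (J, A). (norm (batch_avg b J (r A) - avg n (r A)))\<^sup>2"]
      determined_comp[OF resid_determined, where f = "\<lambda>r (J, A). (1 / real b) * avg n (\<lambda>i. (norm (r A i))\<^sup>2)"]
    by simp_all
  have fh: "measure_pmf.expectation sample_law (f \<omega>) \<le> measure_pmf.expectation sample_law (h \<omega>)" for \<omega>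
    unfolding f_def h_def expectation_pair_finite[OF finite_supports] split_conv
  proof (rule integral_mono)
    fix A
    show "measure_pmf.expectation (uniform_batch n b)
           (\<lambda>J. (norm (batch_avg b J (resid m \<omega> A) - avg n (resid m \<omega> A)))\<^sup>2)
        \<le> measure_pmf.expectation (uniform_batch n b) (\<lambda>J. (1 / real b) * avg n (\<lambda>i. (norm (resid m \<omega> A i))\<^sup>2))"
      using batch_avg_variance[OF n_pos batch_size(1), of "resid m \<omega> A"] by simp
  qed (intro integrable_measure_pmf_finite finite_supports)+
  have int: "integrable M (\<lambda>\<omega>. measure_pmf.expectation sample_law (f \<omega>))"
    "integrable M (\<lambda>\<omega>. measure_pmf.expectation sample_law (h \<omega>))"
    using integrable_determined[OF determined_comp[OF f, where f = "measure_pmf.expectation sample_law"]]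
      integrable_determined[OF determined_comp[OF h, where f = "measure_pmf.expectation sample_law"]]
    by blast+
  have "expectation (\<lambda>\<omega>. (norm (err k \<omega>))\<^sup>2) = expectation (\<lambda>\<omega>. f \<omega> (sample (Suc m) \<omega>))"
    unfolding Suc by (simp add: f_def err_Suc)
  also have "\<dots> \<le> expectation (\<lambda>\<omega>. h \<omega> (sample (Suc m) \<omega>))"
    unfolding expectation_fresh_sample[OF f] expectation_fresh_sample[OF h]
    by (rule integral_mono[OF int fh])
  also have "\<dots> \<le> expectation (\<lambda>\<omega>. (1 / real b) * (2 * move k \<omega> + 18 / (real k + 3)\<^sup>2 * stale k \<omega>))"
  proof (rule integral_mono)
    show "integrable M (\<lambda>\<omega>. h \<omega> (sample (Suc m) \<omega>))"
      by (rule integrable_determined[of "Suc m"], rule determinedI) (simp add: h_def resid_def cong: if_cong)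
    show "integrable M (\<lambda>\<omega>. (1 / real b) * (2 * move k \<omega> + 18 / (real k + 3)\<^sup>2 * stale k \<omega>))"
      by auto
    fix \<omega>
    have gam: "1 - gam k = 3 / (real k + 3)"
      by (simp add: gam_def field_simps)
    have "(norm (resid m \<omega> (H k \<omega>) i))\<^sup>2 \<le> 2 * (norm (G i (x k \<omega>) - G i (x (k - 1) \<omega>)))\<^sup>2
        + 18 / (real k + 3)\<^sup>2 * (norm (G i (x (k - 1) \<omega>) - table k \<omega> i))\<^sup>2" for i
    proof -
      have "resid m \<omega> (H k \<omega>) i = (G i (x k \<omega>) - G i (x (k - 1) \<omega>))
          + (1 - gam k) *\<^sub>R (G i (x (k - 1) \<omega>) - table k \<omega> i)"
        by (simp add: Suc resid_def table_Suc algebra_simps)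
      then have "(norm (resid m \<omega> (H k \<omega>) i))\<^sup>2 \<le> 2 * (norm (G i (x k \<omega>) - G i (x (k - 1) \<omega>)))\<^sup>2
          + 2 * (norm ((1 - gam k) *\<^sub>R (G i (x (k - 1) \<omega>) - table k \<omega> i)))\<^sup>2"
        using norm2_add_le by metis
      also have "2 * (norm ((1 - gam k) *\<^sub>R (G i (x (k - 1) \<omega>) - table k \<omega> i)))\<^sup>2
          = 18 / (real k + 3)\<^sup>2 * (norm (G i (x (k - 1) \<omega>) - table k \<omega> i))\<^sup>2"
        unfolding gam by (simp add: power_mult_distrib power_divide)
      finally show ?thesis .
    qed
    then have "avg n (\<lambda>i. (norm (resid m \<omega> (H k \<omega>) i))\<^sup>2)
        \<le> avg n (\<lambda>i. 2 * (norm (G i (x k \<omega>) - G i (x (k - 1) \<omega>)))\<^sup>2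
        + 18 / (real k + 3)\<^sup>2 * (norm (G i (x (k - 1) \<omega>) - table k \<omega> i))\<^sup>2)"
      by (rule avg_mono)
    also have "\<dots> = 2 * move k \<omega> + 18 / (real k + 3)\<^sup>2 * stale k \<omega>"
      unfolding avg_add avg_mult move_def stale_def ..
    finally show "h \<omega> (sample (Suc m) \<omega>) \<le> (1 / real b) * (2 * move k \<omega> + 18 / (real k + 3)\<^sup>2 * stale k \<omega>)"
      unfolding h_def split_conv Suc by (intro mult_left_mono) auto
  qed
  also have "\<dots> = (1 / real b) * (2 * expectation (move k) + 18 / (real k + 3)\<^sup>2 * expectation (stale k))"
    by simp
  finally show ?thesis .
qed

lemma stale_0: "\<omega> \<in> space M \<Longrightarrow> stale 0 \<omega> = 0"
  by (simp add: stale_def table_0 avg_def)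

text \<open>
  A table entry survives with probability \<open>1 - b / n\<close>; splitting its error between the last move
  and the older error with weight \<open>b / (2 n)\<close> still leaves a contraction.
\<close>
lemma stale_recursion:
  "expectation (stale (Suc k))
     \<le> (1 - real b / (2 * real n)) * expectation (stale k) + 2 * real n / real b * expectation (move k)"
proof -
  define c where "c = (\<lambda>\<omega> i. (norm (G i (x k \<omega>) - table k \<omega> i))\<^sup>2)"
  define f where "f = (\<lambda>\<omega> (J :: nat list, A). avg n (\<lambda>i. if i \<in> A then 0 else c \<omega> i))"
  define \<tau> where "\<tau> = real b / real n"
  have \<tau>: "0 < \<tau>" "\<tau> \<le> 1"
    using n_pos batch_size by (simp_all add: \<tau>_def)
  have det_c: "determined k c"
    by (rule determinedI) (simp add: c_def)
  have det_f: "determined k f"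
    unfolding f_def using determined_comp[OF det_c, where f = "\<lambda>c (J :: nat list, A). avg n (\<lambda>i. if i \<in> A then 0 else c i)"]
    by simp
  have f: "measure_pmf.expectation sample_law (f \<omega>) = (1 - \<tau>) * avg n (c \<omega>)" for \<omega>
    unfolding f_def expectation_pair_finite[OF finite_supports] split_conv \<tau>_def
    using expectation_not_refreshed[OF n_pos b_le_n] by simp
  have "stale (Suc k) = (\<lambda>\<omega>. f \<omega> (sample (Suc k) \<omega>))"
    unfolding stale_def[abs_def] f_def c_def split_conv
    by (intro ext arg_cong[where f = "avg n"]) (simp add: table_Suc)
  then have "expectation (stale (Suc k)) = expectation (\<lambda>\<omega>. (1 - \<tau>) * avg n (c \<omega>))"
    by (simp only: expectation_fresh_sample[OF det_f] f)
  also have "\<dots> \<le> expectation (\<lambda>\<omega>. (1 - \<tau>) * ((1 + 2 / \<tau>) * move k \<omega> + (1 + \<tau> / 2) * stale k \<omega>))"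
  proof (rule integral_mono)
    show "integrable M (\<lambda>\<omega>. (1 - \<tau>) * avg n (c \<omega>))"
      by (rule integrable_determined[of k], rule determined_comp[OF det_c])
    show "integrable M (\<lambda>\<omega>. (1 - \<tau>) * ((1 + 2 / \<tau>) * move k \<omega> + (1 + \<tau> / 2) * stale k \<omega>))"
      by auto
    fix \<omega>
    have "c \<omega> i \<le> (1 + 2 / \<tau>) * (norm (G i (x k \<omega>) - G i (x (k - 1) \<omega>)))\<^sup>2
        + (1 + \<tau> / 2) * (norm (G i (x (k - 1) \<omega>) - table k \<omega> i))\<^sup>2" for i
      using norm2_add_le_weighted[of "\<tau> / 2" "G i (x k \<omega>) - G i (x (k - 1) \<omega>)" "G i (x (k - 1) \<omega>) - table k \<omega> i"] \<tau>
      by (simp add: c_def)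
    then have "avg n (c \<omega>) \<le> avg n (\<lambda>i. (1 + 2 / \<tau>) * (norm (G i (x k \<omega>) - G i (x (k - 1) \<omega>)))\<^sup>2
        + (1 + \<tau> / 2) * (norm (G i (x (k - 1) \<omega>) - table k \<omega> i))\<^sup>2)"
      by (rule avg_mono)
    also have "\<dots> = (1 + 2 / \<tau>) * move k \<omega> + (1 + \<tau> / 2) * stale k \<omega>"
      unfolding avg_add avg_mult move_def stale_def ..
    finally show "(1 - \<tau>) * avg n (c \<omega>) \<le> (1 - \<tau>) * ((1 + 2 / \<tau>) * move k \<omega> + (1 + \<tau> / 2) * stale k \<omega>)"
      using \<tau> by (intro mult_left_mono) auto
  qed
  also have "\<dots> = ((1 - \<tau>) * (1 + \<tau> / 2)) * expectation (stale k) + ((1 - \<tau>) * (1 + 2 / \<tau>)) * expectation (move k)"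
    by (simp add: algebra_simps)
  also have "\<dots> \<le> (1 - \<tau> / 2) * expectation (stale k) + 2 / \<tau> * expectation (move k)"
  proof (intro add_mono mult_right_mono)
    show "(1 - \<tau>) * (1 + \<tau> / 2) \<le> 1 - \<tau> / 2" "(1 - \<tau>) * (1 + 2 / \<tau>) \<le> 2 / \<tau>"
      using \<tau> by (simp_all add: field_simps)
    show "0 \<le> expectation (move k)" "0 \<le> expectation (stale k)"
      by (auto intro: integral_nonneg_AE move_nonneg stale_nonneg)
  qed
  finally show ?thesis
    by (simp add: \<tau>_def mult_ac)
qed

section \<open>The Lyapunov function\<close>

definition grad2 :: "nat \<Rightarrow> real" where
  "grad2 k = expectation (\<lambda>\<omega>. (norm (g k \<omega>))\<^sup>2)"

definition noise :: "nat \<Rightarrow> real" where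
  "noise k = 4 * \<beta>\<^sup>2 * (real k + 3)\<^sup>2 * expectation (\<lambda>\<omega>. (norm (err k \<omega>))\<^sup>2)"

definition mean_energy :: "real^'p \<Rightarrow> nat \<Rightarrow> real" where
  "mean_energy xs k = expectation (\<lambda>\<omega>. energy \<beta> (real k) (x k \<omega> - xs) (v k \<omega>) (g (k - 1) \<omega>))"

lemma grad2_nonneg: "0 \<le> grad2 k" and noise_nonneg: "0 \<le> noise k"
  by (simp_all add: grad2_def noise_def)

lemma mean_energy_step:
  assumes xs: "xs \<in> zer (avg_map n G)"
  shows "mean_energy xs (Suc k) \<le> mean_energy xs k - 16 / 3 * \<beta>\<^sup>2 * (real k + 1) * grad2 k
     - 2 * \<beta> / L * (real k * (real k + 4)) * expectation (move k) + noise k"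
proof -
  define c where "c = (\<lambda>\<omega>. (16 * \<beta>\<^sup>2 / 3 * (real k + 1) * (real k + 3)) *\<^sub>R g k \<omega>
    - (4 * \<beta> * (real k + 3)) *\<^sub>R (anchor (real k) (x k \<omega> - xs) (v k \<omega>) - (4 * \<beta>) *\<^sub>R g k \<omega>))"
  have det: "determined (k - 1) c"
    by (cases k; rule determinedI; simp add: c_def g_def v_def)
  have int: "integrable M (\<lambda>\<omega>. c \<omega> \<bullet> err k \<omega>)"
    by (rule integrable_inner_err[OF determined_mono[OF det]]) simp
  have "mean_energy xs (Suc k) \<le> expectation (\<lambda>\<omega>. energy \<beta> (real k) (x k \<omega> - xs) (v k \<omega>) (g (k - 1) \<omega>)
      - 16 / 3 * \<beta>\<^sup>2 * (real k + 1) * (norm (g k \<omega>))\<^sup>2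
      - 2 * \<beta> / L * (real k * (real k + 4)) * move k \<omega>
      + 4 * \<beta>\<^sup>2 * (real k + 3)\<^sup>2 * (norm (err k \<omega>))\<^sup>2 + c \<omega> \<bullet> err k \<omega>)"
    unfolding mean_energy_def
  proof (rule integral_mono)
    fix \<omega> assume \<omega>: "\<omega> \<in> space M"
    have "energy \<beta> (real k + 1) (x (Suc k) \<omega> - xs) (v (Suc k) \<omega>) (g k \<omega>)
      \<le> energy \<beta> (real k) (x k \<omega> - xs) (v k \<omega>) (g (k - 1) \<omega>)
      - 16 / 3 * \<beta>\<^sup>2 * (real k + 1) * (norm (g k \<omega>))\<^sup>2
      - 2 * \<beta> / L * (real k * (real k + 4)) * move k \<omega>
      + 4 * \<beta>\<^sup>2 * (real k + 3)\<^sup>2 * (norm (err k \<omega>))\<^sup>2 + c \<omega> \<bullet> err k \<omega>"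
      unfolding c_def
      by (rule energy_step[OF _ step_pos L_pos four_step_L_le v_def velocity_recursion[OF \<omega>] _
            monotone_at_zero[OF xs] move_coco move_ge])
        (simp_all add: x_Suc_velocity)
    then show "energy \<beta> (real (Suc k)) (x (Suc k) \<omega> - xs) (v (Suc k) \<omega>) (g (Suc k - 1) \<omega>)
      \<le> energy \<beta> (real k) (x k \<omega> - xs) (v k \<omega>) (g (k - 1) \<omega>)
      - 16 / 3 * \<beta>\<^sup>2 * (real k + 1) * (norm (g k \<omega>))\<^sup>2
      - 2 * \<beta> / L * (real k * (real k + 4)) * move k \<omega>
      + 4 * \<beta>\<^sup>2 * (real k + 3)\<^sup>2 * (norm (err k \<omega>))\<^sup>2 + c \<omega> \<bullet> err k \<omega>"
      by (simp only: of_nat_Suc add.commute diff_Suc_1)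
  qed (intro integrable_iterates integrable_err int Bochner_Integration.integrable_add
      Bochner_Integration.integrable_diff integrable_mult_right)+
  also have "\<dots> = mean_energy xs k - 16 / 3 * \<beta>\<^sup>2 * (real k + 1) * grad2 k
     - 2 * \<beta> / L * (real k * (real k + 4)) * expectation (move k) + noise k"
    by (simp add: int err_unbiased[OF det] mean_energy_def grad2_def noise_def del: One_nat_def)
  finally show ?thesis .
qed

lemma move_0: "move 0 = (\<lambda>\<omega>. 0)"
  by (simp add: move_def avg_def fun_eq_iff)

lemma mean_move_nonneg: "0 \<le> expectation (move k)"
  and mean_stale_nonneg: "0 \<le> expectation (stale k)"
  by (auto intro: integral_nonneg_AE move_nonneg stale_nonneg)

definition stale_weight :: real where
  "stale_weight = 288 * \<beta>\<^sup>2 * real n / (real b)\<^sup>2"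

definition lyapunov :: "real^'p \<Rightarrow> nat \<Rightarrow> real" where
  "lyapunov xs k = mean_energy xs k + stale_weight * expectation (stale k)"

text \<open>
  The weight of the stale term is chosen so that its contraction equals the stale part of twice
  the noise. The terms caused by moves are paid for by cocoercivity, and this is what forces the
  step size to scale like \<open>b ^ 3 / n ^ 2\<close>. The noise is counted twice because one copy cancels
  the noise in the energy and the other one makes the noise summable.
\<close>
lemma noise_absorbed:
  "2 * noise k + stale_weight * expectation (stale (Suc k))
     \<le> stale_weight * expectation (stale k) + 2 * \<beta> / L * (real k * (real k + 4)) * expectation (move k)"
proof -
  let ?a = "expectation (move k)" and ?\<delta> = "expectation (stale k)"
  have a: "0 \<le> ?a"
    by (rule mean_move_nonneg)
  have bn: "real b > 0" "real n > 0"
    using n_pos batch_size by auto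
  have "noise k \<le> 4 * \<beta>\<^sup>2 * (real k + 3)\<^sup>2 * ((1 / real b) * (2 * ?a + 18 / (real k + 3)\<^sup>2 * ?\<delta>))"
    unfolding noise_def by (intro mult_left_mono err_variance) auto
  also have "\<dots> = 8 * \<beta>\<^sup>2 * (real k + 3)\<^sup>2 / real b * ?a + 72 * \<beta>\<^sup>2 / real b * ?\<delta>"
    using bn by (simp add: field_simps)
  finally have 1: "2 * noise k \<le> 16 * \<beta>\<^sup>2 * (real k + 3)\<^sup>2 / real b * ?a + 144 * \<beta>\<^sup>2 / real b * ?\<delta>"
    by simp
  have "stale_weight * expectation (stale (Suc k))
      \<le> stale_weight * ((1 - real b / (2 * real n)) * ?\<delta> + 2 * real n / real b * ?a)"
    unfolding stale_weight_def by (intro mult_left_mono stale_recursion) auto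
  also have "\<dots> = stale_weight * ?\<delta> - 144 * \<beta>\<^sup>2 / real b * ?\<delta> + 576 * \<beta>\<^sup>2 * (real n)\<^sup>2 / real b ^ 3 * ?a"
    using bn unfolding stale_weight_def by (simp add: field_simps power2_eq_square power3_eq_cube)
  finally have 2: "stale_weight * expectation (stale (Suc k))
      \<le> stale_weight * ?\<delta> - 144 * \<beta>\<^sup>2 / real b * ?\<delta> + 576 * \<beta>\<^sup>2 * (real n)\<^sup>2 / real b ^ 3 * ?a" .
  have 3: "(16 * \<beta>\<^sup>2 * (real k + 3)\<^sup>2 / real b + 576 * \<beta>\<^sup>2 * (real n)\<^sup>2 / real b ^ 3) * ?a
      \<le> 2 * \<beta> / L * (real k * (real k + 4)) * ?a"
  proof (cases "k = 0")
    case True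
    then show ?thesis by (simp add: move_0)
  next
    case False
    then have k: "1 \<le> real k" by simp
    have "16 * \<beta>\<^sup>2 * (real k + 3)\<^sup>2 / real b + 576 * \<beta>\<^sup>2 * (real n)\<^sup>2 / real b ^ 3
        = \<beta> * (16 * (real k + 3)\<^sup>2 * (\<beta> / real b) + 576 * (\<beta> * (real n)\<^sup>2 / real b ^ 3))"
      by (simp add: field_simps power2_eq_square)
    also have "\<dots> \<le> \<beta> * (16 * (real k + 3)\<^sup>2 * (1 / (128 * L)) + 576 * (1 / (128 * L)))"
      using step_pos beta_div_b[OF n_pos L_pos batch_size] beta_div_b3[OF n_pos L_pos batch_size]
      by (intro mult_left_mono add_mono) auto
    also have "\<dots> = \<beta> / L * ((real k + 3)\<^sup>2 / 8 + 9 / 2)"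
      using L_pos by (simp add: field_simps)
    also have "\<dots> \<le> \<beta> / L * (2 * (real k * (real k + 4)))"
    proof (intro mult_left_mono)
      have "1 * real k \<le> real k * real k"
        using k by (intro mult_right_mono) auto
      then show "(real k + 3)\<^sup>2 / 8 + 9 / 2 \<le> 2 * (real k * (real k + 4))"
        using k unfolding power2_eq_square by argo
      show "0 \<le> \<beta> / L"
        using step_pos L_pos by simp
    qed
    also have "\<dots> = 2 * \<beta> / L * (real k * (real k + 4))"
      by (simp add: algebra_simps)
    finally show ?thesis
      using a by (rule mult_right_mono)
  qed
  then show ?thesis
    using 1 2 unfolding distrib_right by linarith
qed

lemma lyapunov_step:
  assumes xs: "xs \<in> zer (avg_map n G)"
  shows "lyapunov xs (Suc k) + (16 / 3 * \<beta>\<^sup>2 * (real k + 1) * grad2 k + noise k) \<le> lyapunov xs k"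
  using mean_energy_step[OF xs, of k] noise_absorbed[of k] unfolding lyapunov_def by linarith

lemma lyapunov_0: "lyapunov xs 0 = 16 * (norm (x0 - xs))\<^sup>2"
proof -
  have "mean_energy xs 0 = expectation (\<lambda>\<omega>. 16 * (norm (x0 - xs))\<^sup>2)"
    unfolding mean_energy_def
    by (intro Bochner_Integration.integral_cong) (simp_all add: energy_def anchor_def x_0 power_mult_distrib)
  moreover have "expectation (stale 0) = expectation (\<lambda>\<omega>. 0)"
    by (intro Bochner_Integration.integral_cong) (simp_all add: stale_0)
  ultimately show ?thesis
    by (simp add: lyapunov_def prob_space)
qed

lemma lyapunov_le:
  assumes xs: "xs \<in> zer (avg_map n G)"
  shows "lyapunov xs k \<le> 16 * (norm (x0 - xs))\<^sup>2"
proof (induction k)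
  case (Suc k)
  have "0 \<le> 16 / 3 * \<beta>\<^sup>2 * (real k + 1) * grad2 k"
    using grad2_nonneg by (intro mult_nonneg_nonneg) auto
  then show ?case
    using Suc lyapunov_step[OF xs, of k] noise_nonneg[of k] by linarith
qed (simp add: lyapunov_0)

lemma lyapunov_lower:
  assumes xs: "xs \<in> zer (avg_map n G)"
  shows anchor_le_lyapunov:
      "expectation (\<lambda>\<omega>. (norm (anchor (real k) (x k \<omega> - xs) (v k \<omega>)))\<^sup>2) \<le> 3 * lyapunov xs k"
    and grad2_le_lyapunov: "8 * (\<beta>\<^sup>2 * (real k)\<^sup>2 * grad2 (k - 1)) \<le> 9 * lyapunov xs k"
    and lyapunov_nonneg: "0 \<le> lyapunov xs k"
proof -
  have X: "x k \<omega> - xs = (x (k - 1) \<omega> - xs) - (2 * \<beta>) *\<^sub>R g (k - 1) \<omega> + v k \<omega>" for \<omega>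
    by (simp add: v_def)
  note low = energy_lower[OF of_nat_0_le_iff step_pos L_pos four_step_L_le X monotone_at_zero[OF xs], of k]
  have "0 \<le> stale_weight * expectation (stale k)"
    unfolding stale_weight_def by (intro mult_nonneg_nonneg divide_nonneg_nonneg mean_stale_nonneg) auto
  then have E: "mean_energy xs k \<le> lyapunov xs k"
    by (simp add: lyapunov_def)
  have "expectation (\<lambda>\<omega>. (norm (anchor (real k) (x k \<omega> - xs) (v k \<omega>)))\<^sup>2)
      \<le> expectation (\<lambda>\<omega>. 3 * energy \<beta> (real k) (x k \<omega> - xs) (v k \<omega>) (g (k - 1) \<omega>))"
    by (intro integral_mono low integrable_iterates integrable_mult_right)
  then show 1: "expectation (\<lambda>\<omega>. (norm (anchor (real k) (x k \<omega> - xs) (v k \<omega>)))\<^sup>2) \<le> 3 * lyapunov xs k"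
    using E by (simp add: mean_energy_def)
  have "expectation (\<lambda>\<omega>. 8 * (\<beta>\<^sup>2 * (real k)\<^sup>2 * (norm (g (k - 1) \<omega>))\<^sup>2))
      \<le> expectation (\<lambda>\<omega>. 9 * energy \<beta> (real k) (x k \<omega> - xs) (v k \<omega>) (g (k - 1) \<omega>))"
    by (intro integral_mono low integrable_iterates integrable_mult_right)
  then show "8 * (\<beta>\<^sup>2 * (real k)\<^sup>2 * grad2 (k - 1)) \<le> 9 * lyapunov xs k"
    using E by (simp add: mean_energy_def grad2_def)
  have "0 \<le> expectation (\<lambda>\<omega>. (norm (anchor (real k) (x k \<omega> - xs) (v k \<omega>)))\<^sup>2)"
    by simp
  then show "0 \<le> lyapunov xs k"
    using 1 by linarith
qed

section \<open>Inverse quadratic rates\<close>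

lemma grad2_rate:
  assumes xs: "xs \<in> zer (avg_map n G)"
  shows "\<beta>\<^sup>2 * (real k + 1)\<^sup>2 * grad2 k \<le> 18 * (norm (x0 - xs))\<^sup>2"
  using grad2_le_lyapunov[OF xs, of "Suc k"] lyapunov_le[OF xs, of "Suc k"]
  by (simp add: add.commute)

text \<open>
  The bound 48 on the squared anchor is 16 times the bound 3 claimed here, so the convex
  combination in \<open>distance_step\<close> reproduces the induction hypothesis.
\<close>
lemma distance_bound:
  assumes xs: "xs \<in> zer (avg_map n G)"
  shows "expectation (\<lambda>\<omega>. (norm (x k \<omega> - xs))\<^sup>2) \<le> 3 * (norm (x0 - xs))\<^sup>2"
proof (induction k)
  case 0
  have "expectation (\<lambda>\<omega>. (norm (x 0 \<omega> - xs))\<^sup>2) = expectation (\<lambda>\<omega>. (norm (x0 - xs))\<^sup>2)"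
    by (intro Bochner_Integration.integral_cong) (simp_all add: x_0)
  then show ?case by (simp add: prob_space)
next
  case (Suc k)
  let ?k = "real (Suc k)"
  have "expectation (\<lambda>\<omega>. (?k + 4) * (norm (x (Suc k) \<omega> - xs))\<^sup>2)
      \<le> expectation (\<lambda>\<omega>. ?k * (norm (x k \<omega> - xs))\<^sup>2
        + (norm (anchor ?k (x (Suc k) \<omega> - xs) (v (Suc k) \<omega>)))\<^sup>2 / 4)"
  proof (rule integral_mono)
    fix \<omega>
    show "(?k + 4) * (norm (x (Suc k) \<omega> - xs))\<^sup>2 \<le> ?k * (norm (x k \<omega> - xs))\<^sup>2
        + (norm (anchor ?k (x (Suc k) \<omega> - xs) (v (Suc k) \<omega>)))\<^sup>2 / 4"
      by (rule distance_step[OF of_nat_0_le_iff step_pos L_pos four_step_L_le _ monotone_at_zero[OF xs]])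
        (simp add: x_Suc_velocity)
  qed (intro integrable_iterates integrable_mult_right Bochner_Integration.integrable_add
      integrable_divide_zero)+
  then have "(?k + 4) * expectation (\<lambda>\<omega>. (norm (x (Suc k) \<omega> - xs))\<^sup>2)
      \<le> ?k * expectation (\<lambda>\<omega>. (norm (x k \<omega> - xs))\<^sup>2)
        + expectation (\<lambda>\<omega>. (norm (anchor ?k (x (Suc k) \<omega> - xs) (v (Suc k) \<omega>)))\<^sup>2) / 4"
    by (simp del: of_nat_Suc)
  also have "\<dots> \<le> ?k * (3 * (norm (x0 - xs))\<^sup>2) + 48 * (norm (x0 - xs))\<^sup>2 / 4"
    using Suc anchor_le_lyapunov[OF xs, of "Suc k"] lyapunov_le[OF xs, of "Suc k"]
    by (intro add_mono mult_left_mono divide_right_mono) auto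
  also have "\<dots> = (?k + 4) * (3 * (norm (x0 - xs))\<^sup>2)"
    by (simp add: algebra_simps)
  finally show ?case
    by (simp only: mult_le_cancel_left_pos of_nat_0_less_iff zero_less_Suc add_pos_pos zero_less_numeral)
qed

lemma displacement_rate:
  assumes xs: "xs \<in> zer (avg_map n G)"
  shows "(real k + 5)\<^sup>2 * expectation (\<lambda>\<omega>. (norm (x (Suc k) \<omega> - x k \<omega>))\<^sup>2) \<le> 504 * (norm (x0 - xs))\<^sup>2"
proof -
  let ?u = "\<lambda>\<omega>. anchor (real (Suc k)) (x (Suc k) \<omega> - xs) (v (Suc k) \<omega>)"
  have "expectation (\<lambda>\<omega>. (real k + 5)\<^sup>2 * (norm (x (Suc k) \<omega> - x k \<omega>))\<^sup>2)
      \<le> expectation (\<lambda>\<omega>. 3 * ((norm (?u \<omega>))\<^sup>2 + 16 * (norm (x k \<omega> - xs))\<^sup>2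
          + 4 * (\<beta>\<^sup>2 * (real k + 1)\<^sup>2) * (norm (g k \<omega>))\<^sup>2))"
  proof (rule integral_mono)
    fix \<omega>
    have "(real k + 5) *\<^sub>R (x (Suc k) \<omega> - x k \<omega>)
        = (real k + 1) *\<^sub>R (x (Suc k) \<omega> - x k \<omega>) + 4 *\<^sub>R (x (Suc k) \<omega> - x k \<omega>)"
      by (simp flip: scaleR_add_left)
    also have "\<dots>
        = ?u \<omega> + (- 4) *\<^sub>R (x k \<omega> - xs) + (- (2 * (\<beta> * (real k + 1)))) *\<^sub>R g k \<omega>"
      by (simp add: anchor_def v_def algebra_simps)
    finally have "(real k + 5)\<^sup>2 * (norm (x (Suc k) \<omega> - x k \<omega>))\<^sup>2
        = (norm (?u \<omega> + (- 4) *\<^sub>R (x k \<omega> - xs) + (- (2 * (\<beta> * (real k + 1)))) *\<^sub>R g k \<omega>))\<^sup>2"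
      by (metis norm_scaleR power_mult_distrib power2_abs)
    also have "\<dots> \<le> 3 * ((norm (?u \<omega>))\<^sup>2 + (norm ((- 4) *\<^sub>R (x k \<omega> - xs)))\<^sup>2
        + (norm ((- (2 * (\<beta> * (real k + 1)))) *\<^sub>R g k \<omega>))\<^sup>2)"
      by (rule norm2_add3_le)
    also have "\<dots> = 3 * ((norm (?u \<omega>))\<^sup>2 + 16 * (norm (x k \<omega> - xs))\<^sup>2
          + 4 * (\<beta>\<^sup>2 * (real k + 1)\<^sup>2) * (norm (g k \<omega>))\<^sup>2)"
      unfolding norm_scaleR power_mult_distrib power2_abs power2_minus by simp
    finally show "(real k + 5)\<^sup>2 * (norm (x (Suc k) \<omega> - x k \<omega>))\<^sup>2
        \<le> 3 * ((norm (?u \<omega>))\<^sup>2 + 16 * (norm (x k \<omega> - xs))\<^sup>2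
          + 4 * (\<beta>\<^sup>2 * (real k + 1)\<^sup>2) * (norm (g k \<omega>))\<^sup>2)" .
  qed (intro integrable_iterates integrable_mult_right Bochner_Integration.integrable_add)+
  also have "\<dots> = 3 * (expectation (\<lambda>\<omega>. (norm (?u \<omega>))\<^sup>2) + 16 * expectation (\<lambda>\<omega>. (norm (x k \<omega> - xs))\<^sup>2)
          + 4 * (\<beta>\<^sup>2 * (real k + 1)\<^sup>2 * grad2 k))"
    by (simp add: grad2_def del: of_nat_Suc)
  also have "\<dots> \<le> 504 * (norm (x0 - xs))\<^sup>2"
  proof -
    have "3 * (a + 16 * d + 4 * w) \<le> 504 * r" if "a \<le> 3 * l" "l \<le> 16 * r" "d \<le> 3 * r" "w \<le> 18 * r"
      for a d w l r :: real
      using that by argo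
    then show ?thesis
      using anchor_le_lyapunov[OF xs, of "Suc k"] lyapunov_le[OF xs, of "Suc k"]
        distance_bound[OF xs, of k] grad2_rate[OF xs, of k] by blast
  qed
  finally show ?thesis by simp
qed

section \<open>Rates faster than inverse quadratic\<close>

text \<open>
  The weight 20 is what \<open>momentum_step\<close> spends; it is below four times the \<open>16 / 3\<close> gained by the
  Lyapunov function.
\<close>
lemma summable_gradients_and_noise:
  "summable (\<lambda>k. 20 * \<beta>\<^sup>2 * (real k + 1) * grad2 k + noise k)"
    (is "summable ?s")
proof -
  obtain xs where xs: "xs \<in> zer (avg_map n G)"
    using zer_nonempty by blast
  let ?a = "\<lambda>k. 16 / 3 * \<beta>\<^sup>2 * (real k + 1) * grad2 k + noise k"
  have a: "0 \<le> ?a k" for k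
    using grad2_nonneg[of k] noise_nonneg[of k] by (intro add_nonneg_nonneg mult_nonneg_nonneg) auto
  have "summable ?a"
    by (rule summable_of_decrease[where Y = "lyapunov xs" and s = "\<lambda>k. 0"])
      (use a lyapunov_nonneg[OF xs] lyapunov_step[OF xs] in auto)
  then have "summable (\<lambda>k. 4 * ?a k)"
    by (rule summable_mult)
  then show ?thesis
  proof (rule summable_comparison_test')
    fix k
    have w: "0 \<le> \<beta>\<^sup>2 * (real k + 1) * grad2 k"
      using grad2_nonneg[of k] by simp
    then show "norm (?s k) \<le> 4 * ?a k"
      using noise_nonneg[of k] by simp
  qed
qed

definition velocity2 :: "nat \<Rightarrow> real" where
  "velocity2 k = expectation (\<lambda>\<omega>. (norm (v k \<omega>))\<^sup>2)"

lemma velocity2_nonneg: "0 \<le> velocity2 k"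
  by (simp add: velocity2_def)

definition momentum :: "nat \<Rightarrow> 'w \<Rightarrow> real" where
  "momentum k \<omega> = real k * (real k + 4) * ((norm (v k \<omega>))\<^sup>2 - \<beta> * (g (k - 1) \<omega> \<bullet> v k \<omega>)
     + \<beta>\<^sup>2 * (norm (g (k - 1) \<omega>))\<^sup>2) + 3 / 2 * real k * (norm (v k \<omega>))\<^sup>2"

lemma integrable_momentum: "integrable M (momentum k)"
  by (rule integrable_determined[of k], rule determinedI) (simp add: momentum_def g_def v_def)

text \<open>
  The quadratic form in the momentum is positive definite. The upper bound has the factor
  \<open>k + 4\<close> in front of terms whose sums over \<open>k\<close> are finite.
\<close>
lemma momentum_bounds:
  "real k * (real k + 4) / 2 * (velocity2 k + \<beta>\<^sup>2 * grad2 (k - 1)) \<le> expectation (momentum k)"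
  "expectation (momentum k)
     \<le> (real k + 4) * (3 * real k * velocity2 k + 2 * \<beta>\<^sup>2 * real k * grad2 (k - 1))"
proof -
  let ?h = "\<lambda>\<omega>. g (k - 1) \<omega>" and ?kk = "real k * (real k + 4)"
  have sq: "(norm (v k \<omega> + c *\<^sub>R ?h \<omega>))\<^sup>2 = (norm (v k \<omega>))\<^sup>2 + 2 * c * (?h \<omega> \<bullet> v k \<omega>) + c\<^sup>2 * (norm (?h \<omega>))\<^sup>2" for c \<omega>
    unfolding power2_norm_eq_inner by (simp add: inner_simps inner_commute power2_eq_square algebra_simps)
  have young: "\<bar>\<beta> * (?h \<omega> \<bullet> v k \<omega>)\<bar> \<le> (norm (v k \<omega>))\<^sup>2 / 2 + \<beta>\<^sup>2 * (norm (?h \<omega>))\<^sup>2 / 2" for \<omega>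
    using sq[of \<omega> \<beta>] sq[of \<omega> "- \<beta>"] zero_le_power2[of "norm (v k \<omega> + \<beta> *\<^sub>R ?h \<omega>)"]
      zero_le_power2[of "norm (v k \<omega> + (- \<beta>) *\<^sub>R ?h \<omega>)"] unfolding power2_minus by linarith
  have "expectation (\<lambda>\<omega>. ?kk / 2 * ((norm (v k \<omega>))\<^sup>2 + \<beta>\<^sup>2 * (norm (?h \<omega>))\<^sup>2)) \<le> expectation (momentum k)"
  proof (rule integral_mono)
    fix \<omega>
    have "?kk * (((norm (v k \<omega>))\<^sup>2 + \<beta>\<^sup>2 * (norm (?h \<omega>))\<^sup>2) / 2)
        \<le> ?kk * ((norm (v k \<omega>))\<^sup>2 - \<beta> * (?h \<omega> \<bullet> v k \<omega>) + \<beta>\<^sup>2 * (norm (?h \<omega>))\<^sup>2)"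
      using young[of \<omega>] by (intro mult_left_mono) auto
    moreover have "0 \<le> 3 / 2 * real k * (norm (v k \<omega>))\<^sup>2"
      by simp
    moreover have "?kk / 2 * ((norm (v k \<omega>))\<^sup>2 + \<beta>\<^sup>2 * (norm (?h \<omega>))\<^sup>2)
        = ?kk * (((norm (v k \<omega>))\<^sup>2 + \<beta>\<^sup>2 * (norm (?h \<omega>))\<^sup>2) / 2)"
      by simp
    ultimately show "?kk / 2 * ((norm (v k \<omega>))\<^sup>2 + \<beta>\<^sup>2 * (norm (?h \<omega>))\<^sup>2) \<le> momentum k \<omega>"
      unfolding momentum_def by linarith
  qed (intro integrable_iterates integrable_momentum integrable_mult_right Bochner_Integration.integrable_add)+
  then show "?kk / 2 * (velocity2 k + \<beta>\<^sup>2 * grad2 (k - 1)) \<le> expectation (momentum k)"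
    by (simp add: velocity2_def grad2_def del: One_nat_def)
  have "expectation (momentum k)
      \<le> expectation (\<lambda>\<omega>. (real k + 4) * (3 * real k * (norm (v k \<omega>))\<^sup>2 + 2 * \<beta>\<^sup>2 * real k * (norm (?h \<omega>))\<^sup>2))"
  proof (rule integral_mono)
    fix \<omega>
    have "?kk * ((norm (v k \<omega>))\<^sup>2 - \<beta> * (?h \<omega> \<bullet> v k \<omega>) + \<beta>\<^sup>2 * (norm (?h \<omega>))\<^sup>2)
        \<le> ?kk * (3 / 2 * (norm (v k \<omega>))\<^sup>2 + 3 / 2 * (\<beta>\<^sup>2 * (norm (?h \<omega>))\<^sup>2))"
      using young[of \<omega>] by (intro mult_left_mono) auto
    moreover have "3 / 2 * real k * (norm (v k \<omega>))\<^sup>2 \<le> 3 / 2 * ?kk * (norm (v k \<omega>))\<^sup>2"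
      by (intro mult_right_mono mult_left_mono) (auto simp: algebra_simps)
    moreover have "0 \<le> ?kk * (\<beta>\<^sup>2 * (norm (?h \<omega>))\<^sup>2)"
      by simp
    moreover have "(real k + 4) * (3 * real k * (norm (v k \<omega>))\<^sup>2 + 2 * \<beta>\<^sup>2 * real k * (norm (?h \<omega>))\<^sup>2)
        = ?kk * (3 / 2 * (norm (v k \<omega>))\<^sup>2 + 3 / 2 * (\<beta>\<^sup>2 * (norm (?h \<omega>))\<^sup>2))
          + 3 / 2 * ?kk * (norm (v k \<omega>))\<^sup>2 + ?kk * (\<beta>\<^sup>2 * (norm (?h \<omega>))\<^sup>2) / 2"
      by (simp add: field_simps)
    ultimately show "momentum k \<omega>
        \<le> (real k + 4) * (3 * real k * (norm (v k \<omega>))\<^sup>2 + 2 * \<beta>\<^sup>2 * real k * (norm (?h \<omega>))\<^sup>2)"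
      unfolding momentum_def by linarith
  qed (intro integrable_iterates integrable_momentum integrable_mult_right Bochner_Integration.integrable_add)+
  then show "expectation (momentum k)
     \<le> (real k + 4) * (3 * real k * velocity2 k + 2 * \<beta>\<^sup>2 * real k * grad2 (k - 1))"
    by (simp add: velocity2_def grad2_def del: One_nat_def)
qed

lemma momentum_step:
  "expectation (momentum (Suc k)) + (real k + 1) * velocity2 (Suc k)
     \<le> expectation (momentum k) + (20 * \<beta>\<^sup>2 * (real k + 1) * grad2 k + noise k)"
proof -
  define c where "c = (\<lambda>\<omega>. (2 * \<beta>\<^sup>2 * (real k + 1) * (real k + 3)) *\<^sub>R g k \<omega>
    - (4 * \<beta> * (real k + 3)) *\<^sub>R (real k *\<^sub>R v k \<omega> + (4 * \<beta>) *\<^sub>R g k \<omega>))"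
  have det: "determined (k - 1) c"
    by (cases k; rule determinedI; simp add: c_def g_def v_def)
  have int: "integrable M (\<lambda>\<omega>. c \<omega> \<bullet> err k \<omega>)"
    by (rule integrable_inner_err[OF determined_mono[OF det]]) simp
  have "expectation (\<lambda>\<omega>. momentum (Suc k) \<omega> + (real k + 1) * (norm (v (Suc k) \<omega>))\<^sup>2)
      \<le> expectation (\<lambda>\<omega>. momentum k \<omega> + 20 * \<beta>\<^sup>2 * (real k + 1) * (norm (g k \<omega>))\<^sup>2
        + 4 * \<beta>\<^sup>2 * (real k + 3)\<^sup>2 * (norm (err k \<omega>))\<^sup>2 + c \<omega> \<bullet> err k \<omega>)"
  proof (rule integral_mono)
    fix \<omega> assume \<omega>: "\<omega> \<in> space M"
    have coco: "(g k \<omega> - g (k - 1) \<omega>) \<bullet> (x k \<omega> - x (k - 1) \<omega>) \<ge> (1 / L) * (norm (g k \<omega> - g (k - 1) \<omega>))\<^sup>2"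
      using move_coco[of k \<omega>] mult_left_mono[OF move_ge[of k \<omega>], of "1 / L"] L_pos
      by (meson order_trans less_imp_le zero_le_divide_1_iff)
    show "momentum (Suc k) \<omega> + (real k + 1) * (norm (v (Suc k) \<omega>))\<^sup>2
      \<le> momentum k \<omega> + 20 * \<beta>\<^sup>2 * (real k + 1) * (norm (g k \<omega>))\<^sup>2
        + 4 * \<beta>\<^sup>2 * (real k + 3)\<^sup>2 * (norm (err k \<omega>))\<^sup>2 + c \<omega> \<bullet> err k \<omega>"
      using velocity_step[OF _ step_pos velocity_recursion[OF \<omega>] v_def L_pos four_step_L_le coco]
      unfolding c_def momentum_def by (simp add: add.commute del: One_nat_def)
  qed (intro integrable_iterates integrable_momentum integrable_err int integrable_mult_right
      Bochner_Integration.integrable_add)+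
  then show ?thesis
    by (simp add: int integrable_momentum err_unbiased[OF det] velocity2_def grad2_def noise_def)
qed

lemma momentum_tendsto_0: "(\<lambda>k. expectation (momentum k)) \<longlonglongrightarrow> 0"
proof -
  let ?s = "\<lambda>k. 20 * \<beta>\<^sup>2 * (real k + 1) * grad2 k + noise k"
  let ?w = "\<lambda>k. 3 * real k * velocity2 k + 2 * \<beta>\<^sup>2 * real k * grad2 (k - 1)"
  have s: "0 \<le> ?s k" for k
    using grad2_nonneg[of k] noise_nonneg[of k] by (intro add_nonneg_nonneg mult_nonneg_nonneg) auto
  have nonneg: "0 \<le> expectation (momentum k)" for k
    using momentum_bounds(1)[of k] velocity2_nonneg[of k] grad2_nonneg[of "k - 1"]
    by (intro order_trans[OF _ momentum_bounds(1)] mult_nonneg_nonneg add_nonneg_nonneg) auto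
  have V: "summable (\<lambda>k. (real k + 1) * velocity2 (Suc k))"
    by (rule summable_of_decrease[OF _ nonneg s summable_gradients_and_noise])
      (use momentum_step velocity2_nonneg in auto)
  have \<Gamma>: "summable (\<lambda>k. \<beta>\<^sup>2 * (real k + 1) * grad2 k)"
    by (rule summable_comparison_test'[OF summable_gradients_and_noise])
      (use grad2_nonneg noise_nonneg in \<open>auto simp: mult.assoc intro!: add_increasing2 mult_right_mono\<close>)
  have "summable (\<lambda>k. 3 * ((real k + 1) * velocity2 (Suc k)) + 2 * (\<beta>\<^sup>2 * (real k + 1) * grad2 k))"
    by (intro summable_add summable_mult V \<Gamma>)
  then have "summable (\<lambda>k. ?w (Suc k))"
    by (simp add: algebra_simps)
  then have w: "summable ?w"
    by (subst (asm) summable_Suc_iff)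
  have "summable (\<lambda>k. expectation (momentum k) / (real k + 4))"
  proof (rule summable_comparison_test'[OF w])
    fix k
    have "expectation (momentum k) / (real k + 4) \<le> ?w k"
      using momentum_bounds(2)[of k] by (simp add: pos_divide_le_eq mult.commute)
    then show "norm (expectation (momentum k) / (real k + 4)) \<le> ?w k"
      using nonneg[of k] by simp
  qed
  moreover have "expectation (momentum (Suc k)) \<le> expectation (momentum k) + ?s k" for k
    using momentum_step[of k] mult_nonneg_nonneg[of "real k + 1" "velocity2 (Suc k)"] velocity2_nonneg
    by (smt (verit) of_nat_0_le_iff)
  ultimately show ?thesis
    by (intro tendsto_zero_of_quasi_decreasing[OF nonneg s summable_gradients_and_noise])
qed

lemma velocity_and_gradient_tendsto_0:
  "(\<lambda>k. (real k)\<^sup>2 * velocity2 (Suc k)) \<longlonglongrightarrow> 0"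
  "(\<lambda>k. (real k)\<^sup>2 * grad2 k) \<longlonglongrightarrow> 0"
proof -
  have lim: "(\<lambda>k. 2 * expectation (momentum (Suc k))) \<longlonglongrightarrow> 0"
    using tendsto_mult_right_zero[OF LIMSEQ_Suc[OF momentum_tendsto_0], of 2] .
  have bound: "(real k)\<^sup>2 * velocity2 (Suc k) + \<beta>\<^sup>2 * ((real k)\<^sup>2 * grad2 k) \<le> 2 * expectation (momentum (Suc k))" for k
  proof -
    have "(real k)\<^sup>2 * (velocity2 (Suc k) + \<beta>\<^sup>2 * grad2 k)
        \<le> (real (Suc k) * (real (Suc k) + 4)) * (velocity2 (Suc k) + \<beta>\<^sup>2 * grad2 k)"
      using velocity2_nonneg[of "Suc k"] grad2_nonneg[of k]
      by (intro mult_right_mono add_nonneg_nonneg mult_nonneg_nonneg) (auto simp: power2_eq_square algebra_simps)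
    also have "\<dots> = 2 * (real (Suc k) * (real (Suc k) + 4) / 2 * (velocity2 (Suc k) + \<beta>\<^sup>2 * grad2 (Suc k - 1)))"
      by simp
    also have "\<dots> \<le> 2 * expectation (momentum (Suc k))"
      by (intro mult_left_mono momentum_bounds(1)) simp
    finally show ?thesis
      by (simp add: algebra_simps)
  qed
  have parts: "0 \<le> (real k)\<^sup>2 * velocity2 (Suc k)" "0 \<le> \<beta>\<^sup>2 * ((real k)\<^sup>2 * grad2 k)" for k
    using velocity2_nonneg grad2_nonneg by (auto intro!: mult_nonneg_nonneg)
  show "(\<lambda>k. (real k)\<^sup>2 * velocity2 (Suc k)) \<longlonglongrightarrow> 0"
    by (rule tendsto_sandwich[OF _ _ tendsto_const lim])
      (use bound parts in \<open>auto intro!: always_eventually order_trans[OF _ bound]\<close>)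
  have "(\<lambda>k. \<beta>\<^sup>2 * ((real k)\<^sup>2 * grad2 k)) \<longlonglongrightarrow> 0"
    by (rule tendsto_sandwich[OF _ _ tendsto_const lim])
      (use bound parts in \<open>auto intro!: always_eventually order_trans[OF _ bound]\<close>)
  from tendsto_mult_right_zero[OF this, of "1 / \<beta>\<^sup>2"]
  show "(\<lambda>k. (real k)\<^sup>2 * grad2 k) \<longlonglongrightarrow> 0"
    using step_pos by simp
qed

lemma displacement_tendsto_0:
  "(\<lambda>k. (real k)\<^sup>2 * expectation (\<lambda>\<omega>. (norm (x (Suc k) \<omega> - x k \<omega>))\<^sup>2)) \<longlonglongrightarrow> 0"
proof (rule tendsto_sandwich[OF _ _ tendsto_const])
  show "eventually (\<lambda>k. 0 \<le> (real k)\<^sup>2 * expectation (\<lambda>\<omega>. (norm (x (Suc k) \<omega> - x k \<omega>))\<^sup>2)) sequentially"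
    by (intro always_eventually allI mult_nonneg_nonneg) auto
  have "expectation (\<lambda>\<omega>. (norm (x (Suc k) \<omega> - x k \<omega>))\<^sup>2)
      \<le> expectation (\<lambda>\<omega>. 2 * (norm (v (Suc k) \<omega>))\<^sup>2 + 8 * \<beta>\<^sup>2 * (norm (g k \<omega>))\<^sup>2)" for k
  proof (rule integral_mono)
    fix \<omega>
    have "x (Suc k) \<omega> - x k \<omega> = v (Suc k) \<omega> + (- (2 * \<beta>)) *\<^sub>R g k \<omega>"
      by (simp add: v_def)
    then have "(norm (x (Suc k) \<omega> - x k \<omega>))\<^sup>2 \<le> 2 * (norm (v (Suc k) \<omega>))\<^sup>2 + 2 * (norm ((- (2 * \<beta>)) *\<^sub>R g k \<omega>))\<^sup>2"
      using norm2_add_le by metis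
    then show "(norm (x (Suc k) \<omega> - x k \<omega>))\<^sup>2 \<le> 2 * (norm (v (Suc k) \<omega>))\<^sup>2 + 8 * \<beta>\<^sup>2 * (norm (g k \<omega>))\<^sup>2"
      unfolding norm_scaleR power_mult_distrib power2_abs power2_minus by simp
  qed (intro integrable_iterates integrable_mult_right Bochner_Integration.integrable_add)+
  then have "expectation (\<lambda>\<omega>. (norm (x (Suc k) \<omega> - x k \<omega>))\<^sup>2) \<le> 2 * velocity2 (Suc k) + 8 * \<beta>\<^sup>2 * grad2 k" for k
    by (simp add: velocity2_def grad2_def)
  then have "(real k)\<^sup>2 * expectation (\<lambda>\<omega>. (norm (x (Suc k) \<omega> - x k \<omega>))\<^sup>2)
      \<le> (real k)\<^sup>2 * (2 * velocity2 (Suc k) + 8 * \<beta>\<^sup>2 * grad2 k)" for k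
    by (intro mult_left_mono) auto
  then show "eventually (\<lambda>k. (real k)\<^sup>2 * expectation (\<lambda>\<omega>. (norm (x (Suc k) \<omega> - x k \<omega>))\<^sup>2)
      \<le> 2 * ((real k)\<^sup>2 * velocity2 (Suc k)) + 8 * \<beta>\<^sup>2 * ((real k)\<^sup>2 * grad2 k)) sequentially"
    by (simp add: algebra_simps)
  show "(\<lambda>k. 2 * ((real k)\<^sup>2 * velocity2 (Suc k)) + 8 * \<beta>\<^sup>2 * ((real k)\<^sup>2 * grad2 k)) \<longlonglongrightarrow> 0"
    by (intro tendsto_add_zero tendsto_mult_right_zero velocity_and_gradient_tendsto_0)
qed

section \<open>Oracle complexity\<close>

lemma expected_oracle_calls:
  "expectation (\<lambda>\<omega>. real (oracle_calls n (\<lambda>k. I k \<omega>) (\<lambda>k. H k \<omega>) K)) = real n + 3 * real b * real (K - 1)"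
proof -
  have "oracle_calls n (\<lambda>k. I k \<omega>) (\<lambda>k. H k \<omega>) K = n + 3 * b * (K - 1)" if "\<omega> \<in> space M" for \<omega>
  proof -
    have "(\<Sum>k\<in>{1..<K}. 2 * length (I k \<omega>) + card (H k \<omega>)) = (\<Sum>k\<in>{1..<K}. 3 * b)"
      using batch_space refresh_space that by (intro sum.cong) auto
    then show ?thesis
      by (simp add: oracle_calls_def)
  qed
  then have "expectation (\<lambda>\<omega>. real (oracle_calls n (\<lambda>k. I k \<omega>) (\<lambda>k. H k \<omega>) K))
      = expectation (\<lambda>\<omega>. real n + 3 * real b * real (K - 1))"
    by (intro Bochner_Integration.integral_cong) simp_all
  then show ?thesis
    by (simp add: prob_space)
qed

lemma inverse_beta_le:
  assumes c1: "c1 > 0" and b: "c1 * real n powr (2 / 3) \<le> real b"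
  shows "1 / \<beta> \<le> 256 * L / c1 ^ 3"
proof -
  have bpos: "real b ^ 3 > 0"
    using batch_size by simp
  have "c1 ^ 3 * (real n)\<^sup>2 = (c1 * real n powr (2 / 3)) ^ 3"
    using n_pos by (simp add: power_mult_distrib powr_power powr_numeral)
  also have "\<dots> \<le> real b ^ 3"
    using b c1 by (intro power_mono) auto
  finally have lower: "c1 ^ 3 * (real n)\<^sup>2 \<le> real b ^ 3" .
  have "real b ^ 3 + 64 * (real n)\<^sup>2 \<le> 128 * (real n)\<^sup>2"
    using batch_cube_le[OF n_pos batch_size(2)] by simp
  then have "2 * L * (real b ^ 3 + 64 * (real n)\<^sup>2) / real b ^ 3 \<le> 2 * L * (128 * (real n)\<^sup>2) / real b ^ 3"
    using L_pos bpos by (intro divide_right_mono mult_left_mono) auto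
  then have "1 / \<beta> \<le> 256 * L * ((real n)\<^sup>2 / real b ^ 3)"
    by (simp add: beta_def)
  also have "\<dots> \<le> 256 * L * (1 / c1 ^ 3)"
    using lower L_pos bpos c1 by (intro mult_left_mono) (auto simp: divide_simps mult.commute)
  finally show ?thesis by simp
qed

text \<open>
  Since \<open>5 ^ 2 \<ge> 18\<close>, the bound \<open>grad2_rate\<close> falls below \<open>\<epsilon> ^ 2\<close> after \<open>5 * R / (\<beta> * \<epsilon>)\<close>
  iterations of cost \<open>3 * b\<close>, and \<open>b / \<beta>\<close> is of order \<open>L * n powr (2 / 3)\<close>.
\<close>
lemma oracle_complexity:
  assumes c1: "c1 > 0" and b: "c1 * real n powr (2 / 3) \<le> real b" "real b \<le> c2 * real n powr (2 / 3)"
    and xs: "xs \<in> zer (avg_map n G)" and \<epsilon>: "\<epsilon> > 0"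
  defines "R \<equiv> norm (x0 - xs)"
  shows "\<exists>K. grad2 K \<le> \<epsilon>\<^sup>2 \<and>
    expectation (\<lambda>\<omega>. real (oracle_calls n (\<lambda>k. I k \<omega>) (\<lambda>k. H k \<omega>) K))
      \<le> (1 + 3 * c2 * (5 * 256 / c1 ^ 3)) * (real n + real n powr (2 / 3) * L * R / \<epsilon>)"
proof -
  define K where "K = nat \<lceil>5 * R / (\<beta> * \<epsilon>)\<rceil>"
  have R: "0 \<le> R" by (simp add: R_def)
  have pos: "\<beta> * \<epsilon> > 0" using step_pos \<epsilon> by simp
  have q: "0 \<le> 5 * R / (\<beta> * \<epsilon>)"
    using R pos by simp
  have K1: "5 * R / (\<beta> * \<epsilon>) \<le> real K"
    unfolding K_def by linarith
  have K2: "real (K - 1) \<le> 5 * R / (\<beta> * \<epsilon>)"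
    unfolding K_def using q by linarith
  have "5 * R \<le> \<beta> * \<epsilon> * real K"
    using K1 pos by (simp add: pos_divide_le_eq mult.commute)
  then have "5 * R \<le> \<beta> * \<epsilon> * (real K + 1)"
    using pos by (simp add: distrib_left)
  then have "(5 * R)\<^sup>2 \<le> (\<beta> * \<epsilon> * (real K + 1))\<^sup>2"
    using R by (intro power_mono) auto
  also have "\<dots> = \<beta>\<^sup>2 * (real K + 1)\<^sup>2 * \<epsilon>\<^sup>2"
    by (simp add: power_mult_distrib)
  finally have "(5 * R)\<^sup>2 \<le> \<beta>\<^sup>2 * (real K + 1)\<^sup>2 * \<epsilon>\<^sup>2" .
  moreover have "18 * R\<^sup>2 \<le> (5 * R)\<^sup>2"
    by (simp add: power_mult_distrib)
  moreover have "\<beta>\<^sup>2 * (real K + 1)\<^sup>2 * grad2 K \<le> 18 * R\<^sup>2"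
    unfolding R_def by (rule grad2_rate[OF xs])
  ultimately have "\<beta>\<^sup>2 * (real K + 1)\<^sup>2 * grad2 K \<le> \<beta>\<^sup>2 * (real K + 1)\<^sup>2 * \<epsilon>\<^sup>2"
    by linarith
  then have acc: "grad2 K \<le> \<epsilon>\<^sup>2"
    using step_pos by (simp add: mult_le_cancel_left_pos)
  have c2: "0 < c2"
    using b(2) batch_size n_pos by (smt (verit) of_nat_1 of_nat_le_iff powr_ge_zero mult_nonpos_nonneg)
  let ?N = "real n powr (2 / 3)"
  have "3 * real b * real (K - 1) \<le> 3 * (c2 * ?N) * (5 * R / (\<beta> * \<epsilon>))"
    using b(2) K2 c2 by (intro mult_mono) auto
  also have "\<dots> = 3 * (c2 * ?N) * (5 * R / \<epsilon>) * (1 / \<beta>)"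
    by simp
  also have "\<dots> \<le> 3 * (c2 * ?N) * (5 * R / \<epsilon>) * (256 * L / c1 ^ 3)"
    using inverse_beta_le[OF c1 b(1)] c2 R \<epsilon> by (intro mult_left_mono) auto
  also have "\<dots> = 3 * c2 * (5 * 256 / c1 ^ 3) * (?N * L * R / \<epsilon>)"
    by (simp add: mult_ac)
  finally have cost: "3 * real b * real (K - 1) \<le> 3 * c2 * (5 * 256 / c1 ^ 3) * (?N * L * R / \<epsilon>)" .
  have "0 \<le> ?N * L * R / \<epsilon>" "0 \<le> 3 * c2 * (5 * 256 / c1 ^ 3) * real n"
    using L_pos R \<epsilon> c1 c2 by auto
  then have "real n + 3 * real b * real (K - 1)
      \<le> (1 + 3 * c2 * (5 * 256 / c1 ^ 3)) * (real n + ?N * L * R / \<epsilon>)"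
    using cost unfolding distrib_left distrib_right by linarith
  then show ?thesis
    using acc unfolding expected_oracle_calls[symmetric] by blast
qed

lemma displacement_bound:
  assumes xs: "xs \<in> zer (avg_map n G)" and C: "504 \<le> C"
  shows "expectation (\<lambda>\<omega>. (norm (x (Suc k) \<omega> - x k \<omega>))\<^sup>2) \<le> C * (norm (x0 - xs))\<^sup>2 / (real k + 5)\<^sup>2"
proof -
  have "(real k + 5)\<^sup>2 * expectation (\<lambda>\<omega>. (norm (x (Suc k) \<omega> - x k \<omega>))\<^sup>2) \<le> C * (norm (x0 - xs))\<^sup>2"
    using displacement_rate[OF xs, of k] mult_right_mono[OF C zero_le_power2[of "norm (x0 - xs)"]] by linarith
  then show ?thesis
    by (simp add: pos_le_divide_eq mult.commute)
qed

lemma gradient_bound: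
  assumes xs: "xs \<in> zer (avg_map n G)" and C: "180 \<le> C"
  shows "grad2 k \<le> C * (norm (x0 - xs))\<^sup>2 / (\<beta>\<^sup>2 * (real k + 2) * (real k + 5))"
proof -
  have "(real k + 2) * (real k + 5) \<le> 10 * (real k + 1)\<^sup>2"
    by (simp add: power2_eq_square algebra_simps)
  then have "(real k + 2) * (real k + 5) * (\<beta>\<^sup>2 * grad2 k) \<le> 10 * (real k + 1)\<^sup>2 * (\<beta>\<^sup>2 * grad2 k)"
    using grad2_nonneg[of k] by (intro mult_right_mono) auto
  also have "\<dots> \<le> 180 * (norm (x0 - xs))\<^sup>2"
    using grad2_rate[OF xs, of k] by (simp add: mult_ac)
  also have "\<dots> \<le> C * (norm (x0 - xs))\<^sup>2"
    using C by (intro mult_right_mono) auto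
  finally have "grad2 k * (\<beta>\<^sup>2 * (real k + 2) * (real k + 5)) \<le> C * (norm (x0 - xs))\<^sup>2"
    by (simp add: mult_ac)
  then show ?thesis
    using step_pos by (subst pos_le_divide_eq) auto
qed

lemma constants:
  "C2 n b L \<le> 2559" "C3 n b L \<le> 3636" "1681 \<le> C2 n b L" "2383 \<le> C3 n b L"
proof -
  have "0 \<le> L * \<beta>" "L * \<beta> \<le> 1 / 4"
    using step_pos four_step_L_le L_pos by (auto simp: mult.commute)
  from constant_bounds[OF this psi_eq[OF n_pos L_pos batch_size]]
  show "C2 n b L \<le> 2559" "C3 n b L \<le> 3636" "1681 \<le> C2 n b L" "2383 \<le> C3 n b L"
    by simp_all
qed

lemma convergence:
  "beta n b L \<in> {1 / (2 * L * (1 + 64 * (real n)\<^sup>2)) .. 1 / (4 * L)} \<and>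
        C2 n b L \<le> 2559 \<and> C3 n b L \<le> 3636 \<and>
        (\<forall>k. integrable M (\<lambda>\<omega>. (norm (x (Suc k) \<omega> - x k \<omega>))\<^sup>2) \<and>
             integrable M (\<lambda>\<omega>. (norm (avg_map n G (x k \<omega>)))\<^sup>2)) \<and>
        (\<forall>xstar \<in> zer (avg_map n G). \<forall>k.
           expectation (\<lambda>\<omega>. (norm (x (Suc k) \<omega> - x k \<omega>))\<^sup>2)
             \<le> C2 n b L * (norm (x0 - xstar))\<^sup>2 / (real k + 5)\<^sup>2 \<and>
           expectation (\<lambda>\<omega>. (norm (avg_map n G (x k \<omega>)))\<^sup>2)
             \<le> C3 n b L * (norm (x0 - xstar))\<^sup>2
                / ((beta n b L)\<^sup>2 * (real k + 2) * (real k + 5))) \<and>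
        (\<lambda>k. (real k)\<^sup>2 * expectation (\<lambda>\<omega>. (norm (x (Suc k) \<omega> - x k \<omega>))\<^sup>2))
          \<longlonglongrightarrow> 0 \<and>
        (\<lambda>k. (real k)\<^sup>2 * expectation (\<lambda>\<omega>. (norm (avg_map n G (x k \<omega>)))\<^sup>2))
          \<longlonglongrightarrow> 0"
proof (intro conjI allI ballI)
  show "\<beta> \<in> {1 / (2 * L * (1 + 64 * (real n)\<^sup>2)) .. 1 / (4 * L)}"
    by (rule beta_bounds[OF n_pos L_pos batch_size])
next
  fix k
  show "integrable M (\<lambda>\<omega>. (norm (avg_map n G (x k \<omega>)))\<^sup>2)"
    using integrable_iterates(3)[of k] by (simp only: g_def)
next
  fix xs k assume "xs \<in> zer (avg_map n G)"
  then show "expectation (\<lambda>\<omega>. (norm (avg_map n G (x k \<omega>)))\<^sup>2)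
      \<le> C3 n b L * (norm (x0 - xs))\<^sup>2 / (\<beta>\<^sup>2 * (real k + 2) * (real k + 5))"
    using gradient_bound[of xs "C3 n b L" k] constants by (simp only: grad2_def g_def)
next
  show "(\<lambda>k. (real k)\<^sup>2 * expectation (\<lambda>\<omega>. (norm (avg_map n G (x k \<omega>)))\<^sup>2)) \<longlonglongrightarrow> 0"
    using velocity_and_gradient_tendsto_0(2) by (simp only: grad2_def g_def)
qed (use constants displacement_bound in
    \<open>auto intro: displacement_tendsto_0\<close>)

end

theorem corollary2:
  "(\<forall>(M :: 'w measure) n b I H L (G :: nat \<Rightarrow> real^'p \<Rightarrow> real^'p) x0 x.
      vfkm_saga M n b I H L G x0 x \<longrightarrow>
        beta n b L \<in> {1 / (2 * L * (1 + 64 * (real n)\<^sup>2)) .. 1 / (4 * L)} \<and>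
        C2 n b L \<le> 2559 \<and> C3 n b L \<le> 3636 \<and>
        (\<forall>k. integrable M (\<lambda>\<omega>. (norm (x (Suc k) \<omega> - x k \<omega>))\<^sup>2) \<and>
             integrable M (\<lambda>\<omega>. (norm (avg_map n G (x k \<omega>)))\<^sup>2)) \<and>
        (\<forall>xstar \<in> zer (avg_map n G). \<forall>k.
           prob_space.expectation M (\<lambda>\<omega>. (norm (x (Suc k) \<omega> - x k \<omega>))\<^sup>2)
             \<le> C2 n b L * (norm (x0 - xstar))\<^sup>2 / (real k + 5)\<^sup>2 \<and>
           prob_space.expectation M (\<lambda>\<omega>. (norm (avg_map n G (x k \<omega>)))\<^sup>2)
             \<le> C3 n b L * (norm (x0 - xstar))\<^sup>2
                / ((beta n b L)\<^sup>2 * (real k + 2) * (real k + 5))) \<and>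
        (\<lambda>k. (real k)\<^sup>2 * prob_space.expectation M (\<lambda>\<omega>. (norm (x (Suc k) \<omega> - x k \<omega>))\<^sup>2))
          \<longlonglongrightarrow> 0 \<and>
        (\<lambda>k. (real k)\<^sup>2 * prob_space.expectation M (\<lambda>\<omega>. (norm (avg_map n G (x k \<omega>)))\<^sup>2))
          \<longlonglongrightarrow> 0) \<and>
   (\<forall>c1 > 0. \<forall>c2 > 0. \<exists>C > 0.
      \<forall>(M :: 'w measure) n b I H L (G :: nat \<Rightarrow> real^'p \<Rightarrow> real^'p) x0 x.
        vfkm_saga M n b I H L G x0 x \<longrightarrow>
        c1 * real n powr (2 / 3) \<le> real b \<longrightarrow> real b \<le> c2 * real n powr (2 / 3) \<longrightarrow>
        (\<forall>xstar \<in> zer (avg_map n G). \<forall>\<epsilon> > 0. \<exists>K.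
           prob_space.expectation M (\<lambda>\<omega>. (norm (avg_map n G (x K \<omega>)))\<^sup>2) \<le> \<epsilon>\<^sup>2 \<and>
           prob_space.expectation M
               (\<lambda>\<omega>. real (oracle_calls n (\<lambda>k. I k \<omega>) (\<lambda>k. H k \<omega>) K))
             \<le> C * (real n + real n powr (2 / 3) * L * norm (x0 - xstar) / \<epsilon>)))"
proof (rule conjI; intro allI impI)
  fix c1 c2 :: real assume c: "c1 > 0" "c2 > 0"
  let ?C = "1 + 3 * c2 * (5 * 256 / c1 ^ 3)"
  have "?C > 0"
    using c by (intro add_pos_pos mult_pos_pos divide_pos_pos) auto
  moreover have "\<exists>K. prob_space.expectation M (\<lambda>\<omega>. (norm (avg_map n G (x K \<omega>)))\<^sup>2) \<le> \<epsilon>\<^sup>2 \<and>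
      prob_space.expectation M (\<lambda>\<omega>. real (oracle_calls n (\<lambda>k. I k \<omega>) (\<lambda>k. H k \<omega>) K))
        \<le> ?C * (real n + real n powr (2 / 3) * L * norm (x0 - xstar) / \<epsilon>)"
    if "vfkm_saga M n b I H L G x0 x" "c1 * real n powr (2 / 3) \<le> real b" "real b \<le> c2 * real n powr (2 / 3)"
      "xstar \<in> zer (avg_map n G)" "\<epsilon> > 0"
    for M :: "'w measure" and n b I H L and G :: "nat \<Rightarrow> real^'p \<Rightarrow> real^'p" and x0 x xstar \<epsilon>
    using vfkm_saga.oracle_complexity[OF that(1) c(1) that(2-)]
    unfolding vfkm_saga.grad2_def[OF that(1)] vfkm_saga.g_def[OF that(1)] .
  ultimately show "\<exists>C>0. \<forall>(M :: 'w measure) n b I H L (G :: nat \<Rightarrow> real^'p \<Rightarrow> real^'p) x0 x.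
        vfkm_saga M n b I H L G x0 x \<longrightarrow>
        c1 * real n powr (2 / 3) \<le> real b \<longrightarrow> real b \<le> c2 * real n powr (2 / 3) \<longrightarrow>
        (\<forall>xstar \<in> zer (avg_map n G). \<forall>\<epsilon> > 0. \<exists>K.
           prob_space.expectation M (\<lambda>\<omega>. (norm (avg_map n G (x K \<omega>)))\<^sup>2) \<le> \<epsilon>\<^sup>2 \<and>
           prob_space.expectation M
               (\<lambda>\<omega>. real (oracle_calls n (\<lambda>k. I k \<omega>) (\<lambda>k. H k \<omega>) K))
             \<le> C * (real n + real n powr (2 / 3) * L * norm (x0 - xstar) / \<epsilon>))"
    by (intro exI[of _ ?C] conjI allI impI ballI) blast+
qed (rule vfkm_saga.convergence)

end
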